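(* Let $n\ge 2$ and $1\le s\le n$ be integers, let $r_1,\dots,r_s$ be positive integers with $r_1+\dots+r_s=n$, and let $\mathbb E_E=\mathbb E_{n;s;r_1,\dots,r_s}$ be the corresponding generalized tetrablock. Assume there is $j\in\{1,\dots,s\}$ such that $r_j\ge 3$. Then the Lempert function $l_{\mathbb E_E}$ is not a distance. In particular, $c_{\mathbb E_E}\not\equiv l_{\mathbb E_E}$.
   Context: Given integers $n\ge 2$, $1\le s\le n$ and positive integers $r_1,\dots,r_s$ with $\sum_{j=1}^s r_j=n$, let $A(r_1,\dots,r_s)=\{0,\dots,r_1\}\times\dots\times\{0,\dots,r_s\}\setminus\{(0,\dots,0)\}$, totally ordered by: for $\alpha\ne\beta$, $\alpha<\beta$ iff $\alpha_{j_0}<\beta_{j_0}$ where $j_0=\max\{j:\alpha_j\ne\beta_j\}$. Write $A(r_1,\dots,r_s)=\{\alpha^1<\dots<\alpha^N\}$, $N=\prod_{j=1}^s(r_j+1)-1$. For $x\in\mathbb C^N$, $z\in\mathbb C^s$ put $R_x(z)=1+\sum_{j=1}^N(-1)^{|\alpha^j|}x_jz^{\alpha^j}$, where $|\alpha|=\alpha_1+\dots+\alpha_s$ and $z^\alpha=z_1^{\alpha_1}\cdots z_s^{\alpha_s}$. With $\mathbb D$ the open unit disc in $\mathbb C$, the generalized tetrablock is $\mathbb E_E=\mathbb E_{n;s;r_1,\dots,r_s}=\{x\in\mathbb C^N: R_x(z)\neq 0\text{ for all }z\in\overline{\mathbb D}^s\}$ (here $E$ only refers to the space of matrices $\operatorname{diag}[z_1\mathbb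 I_{r_1},\dots,z_s\mathbb I_{r_s}]$). Let $p$ be the Poincaré distance on $\mathbb D$, $p(\lambda,\mu)=\tanh^{-1}\left|\frac{\lambda-\mu}{1-\overline{\mu}\lambda}\right|$. For a domain $D\subset\mathbb C^N$: the Carathéodory pseudodistance is $c_D(z,w)=\sup\{p(f(z),f(w)): f:D\to\mathbb D\text{ holomorphic}\}$; the Lempert function is $l_D(z,w)=\inf\{p(\lambda,\mu):\exists f:\mathbb D\to D\text{ holomorphic}, f(\lambda)=z, f(\mu)=w\}$. *)

theory Defs
  imports "HOL-Complex_Analysis.Complex_Analysis"
begin

section \<open>Invariant functions\<close>

definition poincare_dist :: "complex \<Rightarrow> complex \<Rightarrow> real" where
  "poincare_dist a b = artanh (cmod ((a - b) / (1 - cnj b * a)))"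

text \<open>Holomorphy of a function of several variables is Frechet differentiability with a
  complex-linear derivative; \<open>has_derivative\<close> only provides real linearity.  The domain is
  meant to be open.\<close>

definition holomorphic_fun_on :: "(complex ^ 'n \<Rightarrow> complex) \<Rightarrow> (complex ^ 'n) set \<Rightarrow> bool" where
  "holomorphic_fun_on f D \<longleftrightarrow>
     (\<forall>x\<in>D. \<exists>L. (f has_derivative L) (at x) \<and> (\<forall>c v. L (c *s v) = c * L v))"

definition holomorphic_curve_on :: "(complex \<Rightarrow> complex ^ 'n) \<Rightarrow> complex set \<Rightarrow> bool" where
  "holomorphic_curve_on f U \<longleftrightarrow> (\<forall>i. (\<lambda>\<zeta>. f \<zeta> $ i) holomorphic_on U)"

text \<open>Both functions take extended real values, so that the supremum and the infimum are the
  genuine ones also for unbounded and for empty sets.\<close>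

definition caratheodory :: "(complex ^ 'n) set \<Rightarrow> complex ^ 'n \<Rightarrow> complex ^ 'n \<Rightarrow> ereal" where
  "caratheodory D z w =
     Sup {ereal (poincare_dist (f z) (f w)) | f. holomorphic_fun_on f D \<and> f ` D \<subseteq> ball 0 1}"

definition lempert :: "(complex ^ 'n) set \<Rightarrow> complex ^ 'n \<Rightarrow> complex ^ 'n \<Rightarrow> ereal" where
  "lempert D z w =
     Inf {ereal (poincare_dist a b) | a b. a \<in> ball 0 1 \<and> b \<in> ball 0 1 \<and>
       (\<exists>f. holomorphic_curve_on f (ball 0 1) \<and> f ` ball 0 1 \<subseteq> D \<and> f a = z \<and> f b = w)}"

text \<open>The locale \<^locale>\<open>Metric_space\<close> also demands non-negativity and symmetry outside of \<open>D\<close>, so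
  the values of \<open>l\<close> are only prescribed on \<open>D\<close>.\<close>

definition is_distance_on :: "'a set \<Rightarrow> ('a \<Rightarrow> 'a \<Rightarrow> ereal) \<Rightarrow> bool" where
  "is_distance_on D l \<longleftrightarrow>
     (\<exists>d. Metric_space D d \<and> (\<forall>z\<in>D. \<forall>w\<in>D. l z w = ereal (d z w)))"


section \<open>The generalized tetrablock\<close>

text \<open>Multi-indices are functions on \<open>{1..s}\<close> (with the arbitrary value \<^term>\<open>undefined\<close>
  elsewhere).\<close>

definition multi_indices :: "nat \<Rightarrow> (nat \<Rightarrow> nat) \<Rightarrow> (nat \<Rightarrow> nat) set" where
  "multi_indices s r = (\<Pi>\<^sub>E j\<in>{1..s}. {0..r j}) - {\<lambda>j\<in>{1..s}. 0}"

definition multi_less :: "nat \<Rightarrow> (nat \<Rightarrow> nat) \<Rightarrow> (nat \<Rightarrow> nat) \<Rightarrow> bool" where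
  "multi_less s \<alpha> \<beta> \<longleftrightarrow>
     \<alpha> \<noteq> \<beta> \<and> (let j\<^sub>0 = Max {j\<in>{1..s}. \<alpha> j \<noteq> \<beta> j} in \<alpha> j\<^sub>0 < \<beta> j\<^sub>0)"

text \<open>The \<open>k\<close>-th multi-index \<open>\<alpha>\<^sup>k\<close>, \<open>k = 1, \<dots>, N\<close>, is the one with exactly \<open>k - 1\<close> predecessors.\<close>

definition nth_multi_index :: "nat \<Rightarrow> (nat \<Rightarrow> nat) \<Rightarrow> nat \<Rightarrow> (nat \<Rightarrow> nat)" where
  "nth_multi_index s r k =
     (THE \<alpha>. \<alpha> \<in> multi_indices s r \<and> card {\<beta> \<in> multi_indices s r. multi_less s \<beta> \<alpha>} = k - 1)"

text \<open>The coordinates of \<open>\<complex>\<^sup>N\<close> are indexed by a linearly ordered finite type \<open>'N\<close> with \<open>N\<close> elements;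
  its elements are numbered \<open>1, \<dots>, N\<close> in increasing order.\<close>

definition position :: "'N::{finite,linorder} \<Rightarrow> nat" where
  "position i = card {k. k \<le> i}"

definition R_poly ::
  "nat \<Rightarrow> (nat \<Rightarrow> nat) \<Rightarrow> complex ^ 'N::{finite,linorder} \<Rightarrow> (nat \<Rightarrow> complex) \<Rightarrow> complex" where
  "R_poly s r x z =
     1 + (\<Sum>i\<in>UNIV. let \<alpha> = nth_multi_index s r (position i) in
            (-1) ^ (\<Sum>j=1..s. \<alpha> j) * x $ i * (\<Prod>j=1..s. z j ^ \<alpha> j))"

definition gen_tetrablock ::
  "nat \<Rightarrow> (nat \<Rightarrow> nat) \<Rightarrow> (complex ^ 'N::{finite,linorder}) set" where
  "gen_tetrablock s r = {x. \<forall>z. (\<forall>j\<in>{1..s}. z j \<in> cball 0 1) \<longrightarrow> R_poly s r x z \<noteq> 0}"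


section \<open>The enumeration of the multi-indices is well defined\<close>

lemma finite_multi_indices: "finite (multi_indices s r)"
  unfolding multi_indices_def by (intro finite_Diff finite_PiE) auto

lemma card_multi_indices: "card (multi_indices s r) = (\<Prod>j=1..s. (r j + 1)) - 1"
proof -
  have "(\<lambda>j\<in>{1..s}. 0) \<in> (\<Pi>\<^sub>E j\<in>{1..s}. {0..r j})" by auto
  then show ?thesis
    unfolding multi_indices_def by (simp add: card_Diff_singleton card_PiE)
qed

lemma multi_less_iff:
  assumes "\<alpha> \<in> multi_indices s r" "\<beta> \<in> multi_indices s r"
  shows "multi_less s \<alpha> \<beta> \<longleftrightarrow> (\<exists>j\<in>{1..s}. \<alpha> j < \<beta> j \<and> (\<forall>k\<in>{1..s}. j < k \<longrightarrow> \<alpha> k = \<beta> k))"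
    (is "_ \<longleftrightarrow> ?R")
proof
  let ?S = "{j\<in>{1..s}. \<alpha> j \<noteq> \<beta> j}"
  assume L: "multi_less s \<alpha> \<beta>"
  then have "\<alpha> \<noteq> \<beta>" by (simp add: multi_less_def)
  then have "?S \<noteq> {}"
    using assms PiE_ext[of \<alpha> "{1..s}" _ \<beta>] unfolding multi_indices_def by blast
  then have "Max ?S \<in> ?S" by (intro Max_in) auto
  moreover have "\<alpha> k = \<beta> k" if "k \<in> {1..s}" "Max ?S < k" for k
  proof (rule ccontr)
    assume "\<alpha> k \<noteq> \<beta> k"
    then have "k \<le> Max ?S" using that(1) by (intro Max_ge) auto
    then show False using that(2) by simp
  qed
  moreover have "\<alpha> (Max ?S) < \<beta> (Max ?S)"
    using L unfolding multi_less_def Let_def by blast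
  ultimately show ?R by blast
next
  assume ?R
  then obtain j where j: "j \<in> {1..s}" "\<alpha> j < \<beta> j" "\<forall>k\<in>{1..s}. j < k \<longrightarrow> \<alpha> k = \<beta> k" by blast
  have "Max {j\<in>{1..s}. \<alpha> j \<noteq> \<beta> j} = j"
  proof (rule Max_eqI)
    show "k \<le> j" if "k \<in> {j\<in>{1..s}. \<alpha> j \<noteq> \<beta> j}" for k
      using that j(3) by (metis (mono_tags, lifting) mem_Collect_eq not_le)
  qed (use j in auto)
  moreover have "\<alpha> \<noteq> \<beta>" using j(2) by blast
  ultimately show "multi_less s \<alpha> \<beta>" using j(2) by (simp add: multi_less_def)
qed

lemma multi_less_total:
  assumes "\<alpha> \<in> multi_indices s r" "\<beta> \<in> multi_indices s r" "\<alpha> \<noteq> \<beta>"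
  shows "multi_less s \<alpha> \<beta> \<or> multi_less s \<beta> \<alpha>"
proof -
  let ?S = "{j\<in>{1..s}. \<alpha> j \<noteq> \<beta> j}"
  have "?S \<noteq> {}"
    using assms PiE_ext[of \<alpha> "{1..s}" _ \<beta>] unfolding multi_indices_def by blast
  then have "Max ?S \<in> ?S" by (intro Max_in) auto
  moreover have "{j\<in>{1..s}. \<beta> j \<noteq> \<alpha> j} = ?S" by auto
  ultimately show ?thesis
    using assms(3) unfolding multi_less_def Let_def by auto
qed

lemma multi_less_trans:
  assumes "\<alpha> \<in> multi_indices s r" "\<beta> \<in> multi_indices s r" "\<gamma> \<in> multi_indices s r"
    "multi_less s \<alpha> \<beta>" "multi_less s \<beta> \<gamma>"
  shows "multi_less s \<alpha> \<gamma>"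
proof -
  obtain j where j: "j \<in> {1..s}" "\<alpha> j < \<beta> j" "\<forall>k\<in>{1..s}. j < k \<longrightarrow> \<alpha> k = \<beta> k"
    using assms multi_less_iff by blast
  obtain i where i: "i \<in> {1..s}" "\<beta> i < \<gamma> i" "\<forall>k\<in>{1..s}. i < k \<longrightarrow> \<beta> k = \<gamma> k"
    using assms multi_less_iff by blast
  have "\<alpha> (max i j) < \<gamma> (max i j)"
    using i j by (cases i j rule: linorder_cases) (auto simp: max_def)
  moreover have "max i j \<in> {1..s}" "\<forall>k\<in>{1..s}. max i j < k \<longrightarrow> \<alpha> k = \<gamma> k"
    using i j by auto
  ultimately show ?thesis using assms(1,3) multi_less_iff by blast
qed

lemma nth_multi_index_bij:
  shows "bij_betw (nth_multi_index s r) {1..card (multi_indices s r)} (multi_indices s r)"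
    and "\<And>i k. \<lbrakk>1 \<le> i; i < k; k \<le> card (multi_indices s r)\<rbrakk>
           \<Longrightarrow> multi_less s (nth_multi_index s r i) (nth_multi_index s r k)"
proof -
  define A where "A = multi_indices s r"
  define P where "P = (\<lambda>\<alpha>. {\<beta> \<in> A. multi_less s \<beta> \<alpha>})"
  define rk where "rk = (\<lambda>\<alpha>. Suc (card (P \<alpha>)))"
  have fin: "finite A" by (simp add: A_def finite_multi_indices)
  have irr: "\<not> multi_less s \<alpha> \<alpha>" for \<alpha> by (simp add: multi_less_def)
  have mono: "rk \<alpha> < rk \<beta>" if "\<alpha> \<in> A" "\<beta> \<in> A" "multi_less s \<alpha> \<beta>" for \<alpha> \<beta>
  proof -
    have "P \<alpha> \<subseteq> P \<beta>" using that multi_less_trans unfolding P_def A_def by blast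
    moreover have "\<alpha> \<in> P \<beta>" "\<alpha> \<notin> P \<alpha>" using that irr by (auto simp: P_def)
    ultimately have "P \<alpha> \<subset> P \<beta>" by blast
    then show ?thesis unfolding rk_def using fin by (simp add: psubset_card_mono P_def)
  qed
  have inj: "inj_on rk A"
    by (rule inj_onI) (metis mono multi_less_total A_def less_irrefl)
  have "rk \<alpha> \<in> {1..card A}" if "\<alpha> \<in> A" for \<alpha>
  proof -
    have "P \<alpha> \<subset> A" using that irr by (auto simp: P_def)
    then show ?thesis unfolding rk_def using fin psubset_card_mono[of A "P \<alpha>"] by simp
  qed
  then have img: "rk ` A = {1..card A}"
    by (intro card_subset_eq) (auto simp: card_image[OF inj])
  have nth: "nth_multi_index s r (rk \<alpha>) = \<alpha>" if "\<alpha> \<in> A" for \<alpha>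
    unfolding nth_multi_index_def A_def[symmetric]
  proof (rule the_equality)
    show "\<alpha> \<in> A \<and> card {\<beta> \<in> A. multi_less s \<beta> \<alpha>} = rk \<alpha> - 1"
      using that by (simp add: rk_def P_def)
    show "\<beta> = \<alpha>" if "\<beta> \<in> A \<and> card {\<gamma> \<in> A. multi_less s \<gamma> \<beta>} = rk \<alpha> - 1" for \<beta>
      using that \<open>\<alpha> \<in> A\<close> inj_onD[OF inj, of \<beta> \<alpha>] by (simp add: rk_def P_def)
  qed
  have inv: "nth_multi_index s r k \<in> A \<and> rk (nth_multi_index s r k) = k" if "k \<in> {1..card A}" for k
    using that nth unfolding img[symmetric] by auto
  show "bij_betw (nth_multi_index s r) {1..card (multi_indices s r)} (multi_indices s r)"
    using inv nth img unfolding A_def[symmetric]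
    by (intro bij_betw_byWitness[where f' = rk]) auto
  show "multi_less s (nth_multi_index s r i) (nth_multi_index s r k)"
    if "1 \<le> i" "i < k" "k \<le> card (multi_indices s r)" for i k
  proof -
    have i: "nth_multi_index s r i \<in> A" "rk (nth_multi_index s r i) = i"
      and k: "nth_multi_index s r k \<in> A" "rk (nth_multi_index s r k) = k"
      using inv[of i] inv[of k] that by (auto simp: A_def)
    then show ?thesis
      using mono[of "nth_multi_index s r k" "nth_multi_index s r i"] that
        multi_less_total[of "nth_multi_index s r i" s r "nth_multi_index s r k"]
      unfolding A_def by fastforce
  qed
qed

end

theory Submission
  imports Defs "HOL-Computational_Algebra.Fundamental_Theorem_Algebra"
begin

unbundle no fps_syntax

text \<open>The triangle inequality fails for the Lempert function, on a one-variable slice.  Fix \<open>J\<close> with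
  \<open>n = r\<^sub>J \<ge> 3\<close>.  Keeping only the monomials that are powers of \<open>z\<^sub>J\<close> retracts the tetrablock
  holomorphically onto the polynomials \<open>P\<close> of degree at most \<open>n\<close> with \<open>P(0) = 1\<close> and no zero in the
  closed unit disc (the symmetrized polydisc: \<open>P(w) = \<Prod>(1 - \<lambda>\<^sub>i w)\<close> with \<open>|\<lambda>\<^sub>i| < 1\<close>).  So it suffices to
  work with holomorphic discs of such polynomials.

  The obstruction is infinitesimal.  Let \<open>\<zeta> \<mapsto> P\<^sub>\<zeta>\<close> be a disc with coefficients \<open>c\<^sub>j(\<zeta>)\<close>, such that at
  \<open>\<zeta> = 0\<close> three of the \<open>\<lambda>\<^sub>i\<close> vanish.  If moreover \<open>c\<^sub>n'(0) = 0\<close>, then \<open>|c\<^sub>n\<^sub>-\<^sub>1'(0)| \<le> 1\<close>: among the products of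
  \<open>n - 1\<close> of the \<open>\<lambda>\<^sub>i\<close>, all bounded by one, the largest behaves like \<open>|c\<^sub>n\<^sub>-\<^sub>1'(0) \<zeta>|\<close> near \<open>0\<close>, and a maximum
  principle for its quotient by \<open>|\<zeta>|\<close> gives the bound (lemma \<open>cofactor_disc_bound\<close>).  Without the
  condition on \<open>c\<^sub>n'(0)\<close> the bound is false: \<open>cubic_disc\<close> gives, for \<open>n = 3\<close>, explicit discs with
  \<open>c\<^sub>2'(0) = - 9/8\<close> and \<open>c\<^sub>3'(0) = \<mp> 1/8\<close>.  A fixed factor \<open>v(w) = (1 - b w)\<^sup>n\<^sup>-\<^sup>3\<close> with \<open>b\<close> slightly below one
  carries them to degree \<open>n\<close>; the leading coefficient of \<open>v\<close> has modulus \<open>b\<^sup>n\<^sup>-\<^sup>3\<close>, close to one.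

  Averaging the velocities of the two discs \<open>e = 1\<close> and \<open>e = - 1\<close> cancels \<open>c\<^sub>n'\<close>.  Accordingly, let \<open>p\<close> be the
  first disc at \<open>\<tau>\<close>, let \<open>q\<close> be the second one at \<open>- \<tau>\<close>, and let \<open>v\<close> be their common centre.  The path from
  \<open>p\<close> through \<open>v\<close> to \<open>q\<close> has Lempert length at most \<open>2 artanh \<tau> < artanh (2 \<tau>)\<close>.  If single discs joined
  \<open>q\<close> (at \<open>0\<close>) to \<open>p\<close> (at some \<open>\<alpha>\<close> with \<open>|\<alpha>| < 2 \<tau>\<close>) for arbitrarily small \<open>\<tau>\<close>, a limit disc given by
  Montel's theorem would have \<open>c\<^sub>n'(0) = 0\<close> and \<open>|c\<^sub>n\<^sub>-\<^sub>1'(0)| \<ge> (9/8) b\<^sup>n\<^sup>-\<^sup>3 > 1\<close>, which is impossible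
  (lemmas \<open>shrinking_discs_bound\<close> and \<open>exists_far_polynomials\<close>).  Hence \<open>p\<close> and \<open>q\<close> are further apart
  than the path through \<open>v\<close> is long, for some \<open>\<tau>\<close>.  The Caratheodory function inherits the triangle
  inequality from the Poincare distance, so it differs from the Lempert function as well.\<close>


section \<open>Polynomials without zeros in the unit disc\<close>

lemma zero_free_poly_split:
  fixes P :: "complex poly"
  assumes zf: "\<And>z. norm z < 1 \<Longrightarrow> poly P z \<noteq> 0" and c0: "coeff P 0 = 1"
    and deg: "degree P \<le> Suc n" and root: "poly P w = 0"
  obtains K where "P = [:1, - (1 / w):] * K" "coeff K 0 = 1" "degree K \<le> n"
    "\<And>z. norm z < 1 \<Longrightarrow> poly K z \<noteq> 0" "1 \<le> norm w"
proof -
  have w1: "1 \<le> norm w" using zf root by (meson not_le)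
  then have w0: "w \<noteq> 0" by auto
  obtain K0 where K0: "P = [:- w, 1:] * K0"
    using root by (metis dvdE poly_eq_0_iff_dvd)
  define K where "K = smult (- w) K0"
  have P: "P = [:1, - (1 / w):] * K"
    unfolding K0 K_def using w0 by (simp add: algebra_simps)
  have "P \<noteq> 0" using c0 by auto
  then have "K \<noteq> 0" using P by auto
  have "degree ([:1, - (1 / w):] * K) = Suc (degree K)"
    using w0 \<open>K \<noteq> 0\<close> by (subst degree_mult_eq) auto
  then have "degree K \<le> n" using deg P by simp
  moreover have "coeff K 0 = 1" using c0 unfolding P by simp
  moreover have "poly K z \<noteq> 0" if "norm z < 1" for z
    using zf[OF that] unfolding P by auto
  ultimately show thesis using that P w1 by blast
qed

text \<open>With \<open>P(w) = \<Prod>(1 - \<lambda>\<^sub>i w)\<close> and \<open>|\<lambda>\<^sub>i| \<le> 1\<close>, the \<open>j\<close>-th coefficient is a sum of \<open>n choose j\<close> products of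
  modulus at most one, and each of the \<open>n\<close> factors is at least \<open>1 - |w|\<close>.  The induction splits off one
  root at a time.  Unlike zero-freeness, the lower bound survives pointwise limits.\<close>

lemma zero_free_poly_bounds:
  fixes P :: "complex poly"
  assumes "\<And>z. norm z < 1 \<Longrightarrow> poly P z \<noteq> 0" and "coeff P 0 = 1" and "degree P \<le> n"
  shows "norm (coeff P j) \<le> real (n choose j)"
    and "norm v \<le> 1 \<Longrightarrow> (1 - norm v) ^ n \<le> norm (poly P v)"
proof -
  have "norm (coeff P j) \<le> real (n choose j) \<and> (norm v \<le> 1 \<longrightarrow> (1 - norm v) ^ n \<le> norm (poly P v))"
    using assms
  proof (induction n arbitrary: P j)
    case 0
    then have "P = 1" by (metis coeff_pCons_0 le_zero_eq one_pCons degree_eq_zeroE)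
    then show ?case by (cases j) auto
  next
    case (Suc n)
    show ?case
    proof (cases "degree P = 0")
      case True
      then have "P = 1" using Suc.prems(2) by (metis coeff_pCons_0 one_pCons degree_eq_zeroE)
      then show ?thesis by (cases j) (use power_le_one[of "1 - norm v" "Suc n"] in auto)
    next
      case False
      then obtain w where "poly P w = 0"
        using fundamental_theorem_of_algebra[of P] by (auto simp: constant_degree)
      then obtain K where K: "P = [:1, - (1 / w):] * K" "coeff K 0 = 1" "degree K \<le> n"
        "\<And>z. norm z < 1 \<Longrightarrow> poly K z \<noteq> 0" "1 \<le> norm w"
        using zero_free_poly_split[OF Suc.prems] by metis
      have IH: "norm (coeff K i) \<le> real (n choose i)"
        "norm v \<le> 1 \<Longrightarrow> (1 - norm v) ^ n \<le> norm (poly K v)" for i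
        using Suc.IH[of K i] K by auto
      have w: "norm (1 / w) \<le> 1" using K(5) by (simp add: norm_divide divide_simps)
      have "norm (coeff P j) \<le> real (Suc n choose j)"
      proof (cases j)
        case 0
        then show ?thesis using Suc.prems(2) by simp
      next
        case (Suc i)
        have "coeff P j = coeff K (Suc i) - (1 / w) * coeff K i" by (simp add: K(1) Suc)
        also have "norm \<dots> \<le> norm (coeff K (Suc i)) + norm ((1 / w) * coeff K i)"
          by (rule norm_triangle_ineq4)
        also have "\<dots> \<le> real (n choose Suc i) + 1 * real (n choose i)"
          unfolding norm_mult by (intro add_mono mult_mono IH w) auto
        finally show ?thesis by (simp add: Suc)
      qed
      moreover have "(1 - norm v) ^ Suc n \<le> norm (poly P v)" if v: "norm v \<le> 1"
      proof -
        have "1 - norm v \<le> 1 - norm (v * (1 / w))"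
          using mult_left_mono[OF w, of "norm v"]
          by (simp add: norm_mult del: mult_1_right times_divide_eq_right)
        also have "\<dots> \<le> norm (1 - v * (1 / w))"
          by (metis norm_one norm_triangle_ineq2)
        finally have "(1 - norm v) * (1 - norm v) ^ n \<le> norm (1 - v * (1 / w)) * norm (poly K v)"
          using IH(2) v by (intro mult_mono) auto
        also have "\<dots> = norm (poly P v)"
          unfolding K(1) norm_mult[symmetric] by (simp add: algebra_simps)
        finally show ?thesis by simp
      qed
      ultimately show ?thesis by blast
    qed
  qed
  then show "norm (coeff P j) \<le> real (n choose j)"
    and "norm v \<le> 1 \<Longrightarrow> (1 - norm v) ^ n \<le> norm (poly P v)" by auto
qed

text \<open>For \<open>P(w) = \<Prod>(1 - \<lambda>\<^sub>i w)\<close> with coefficients \<open>c\<^sub>j\<close> this is \<open>\<Prod>(1 \<plusminus> y\<^sub>i v)\<close>, where \<open>y\<^sub>i\<close> is the product of all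
  \<open>\<lambda>\<^sub>j\<close> with \<open>j \<noteq> i\<close>, and the sign is that of \<open>(-1)\<^sup>n\<^sup>-\<^sup>1\<close>: the elementary symmetric functions of the
  \<open>y\<^sub>i\<close> are, up to sign, \<open>c\<^sub>n\<^sub>-\<^sub>i c\<^sub>n\<^sup>i\<^sup>-\<^sup>1\<close>.\<close>

definition cofactor_poly :: "nat \<Rightarrow> (nat \<Rightarrow> complex) \<Rightarrow> complex \<Rightarrow> complex" where
  "cofactor_poly n c v = 1 + (\<Sum>i=1..n. c (n - i) * c n ^ (i - 1) * v ^ i)"

text \<open>The products \<open>y\<^sub>i\<close> have modulus at most one, so the cofactor polynomial has no zero in the open disc
  either and the general lower bound applies to it.  The proof avoids the \<open>y\<^sub>i\<close>: for \<open>d = c\<^sub>n \<noteq> 0\<close> a zero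
  \<open>u\<close> gives the zero \<open>1 / (d u)\<close> of \<open>P\<close>, and after splitting it off the top coefficient of the quotient
  is at most one.\<close>

lemma cofactor_poly_lower_bound:
  fixes P :: "complex poly"
  assumes zf: "\<And>z. norm z < 1 \<Longrightarrow> poly P z \<noteq> 0" and c0: "coeff P 0 = 1"
    and deg: "degree P \<le> n" and n: "n \<ge> 1" and v: "norm v \<le> 1"
  shows "(1 - norm v) ^ n \<le> norm (cofactor_poly n (coeff P) v)"
proof -
  define d where "d = coeff P n"
  define Z where "Z = 1 + (\<Sum>i=1..n. monom (coeff P (n - i) * d ^ (i - 1)) i)"
  have polyZ: "poly Z u = cofactor_poly n (coeff P) u" for u
    by (simp add: Z_def cofactor_poly_def d_def poly_sum poly_monom)
  obtain m where m: "n = Suc m" using n by (cases n) auto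
  have "coeff Z 0 = 1"
    by (simp add: Z_def coeff_sum)
  moreover have "degree Z \<le> n"
    unfolding Z_def by (intro degree_add_le degree_sum_le) (auto intro: order_trans[OF degree_monom_le])
  moreover have "poly Z u \<noteq> 0" if u: "norm u < 1" for u
  proof
    assume Z0: "poly Z u = 0"
    show False
    proof (cases "d = 0")
      case True
      have "degree P \<le> m"
        using deg True leading_coeff_0_iff[of P] unfolding m d_def
        by (cases "degree P = Suc m") auto
      then have "norm (coeff P m) \<le> real (m choose m)"
        by (intro zero_free_poly_bounds(1) zf c0)
      moreover have "poly Z u = 1 + coeff P m * u"
      proof -
        have "(\<Sum>i=1..n. coeff P (n - i) * d ^ (i - 1) * u ^ i)
            = (\<Sum>i\<in>{1}. coeff P (n - i) * d ^ (i - 1) * u ^ i)"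
          using n True by (intro sum.mono_neutral_right) auto
        then show ?thesis by (simp add: polyZ cofactor_poly_def d_def m)
      qed
      ultimately have "norm (coeff P m * u) < 1"
        using u by (simp add: norm_mult) (metis mult_left_le_one_le norm_ge_zero order_le_less_trans)
      then show False using Z0 \<open>poly Z u = 1 + coeff P m * u\<close>
        by (metis add_eq_0_iff norm_minus_cancel norm_one order_less_irrefl)
    next
      case False
      have u0: "u \<noteq> 0" using Z0 by (auto simp: polyZ cofactor_poly_def power_0_left)
      define w where "w = 1 / (d * u)"
      \<comment> \<open>\<open>(d u)\<^sup>n P(1 / (d u))\<close> is the reversed polynomial of \<open>P\<close> at \<open>d u\<close>, which is \<open>d Z(u)\<close>.\<close>
      have "(d * u) ^ n * poly P w = (\<Sum>j\<le>n. coeff P j * (d * u) ^ (n - j))"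
      proof -
        have "poly P w = (\<Sum>j\<le>n. coeff P j * w ^ j)"
          unfolding poly_altdef using deg
          by (intro sum.mono_neutral_left) (auto simp: coeff_eq_0)
        then have "(d * u) ^ n * poly P w = (\<Sum>j\<le>n. coeff P j * ((d * u) ^ n * w ^ j))"
          by (simp add: sum_distrib_left algebra_simps)
        also have "\<dots> = (\<Sum>j\<le>n. coeff P j * (d * u) ^ (n - j))"
          using False u0 by (intro sum.cong refl) (simp add: w_def power_diff power_divide)
        finally show ?thesis .
      qed
      also have "\<dots> = (\<Sum>i\<le>n. coeff P (n - i) * (d * u) ^ i)"
        by (rule sum.reindex_bij_witness[where i = "\<lambda>i. n - i" and j = "\<lambda>i. n - i"]) auto
      also have "\<dots> = d + (\<Sum>i=1..n. coeff P (n - i) * (d * u) ^ i)"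
        by (simp add: atMost_atLeast0 sum.atLeast_Suc_atMost d_def)
      also have "(\<Sum>i=1..n. coeff P (n - i) * (d * u) ^ i)
          = d * (\<Sum>i=1..n. coeff P (n - i) * d ^ (i - 1) * u ^ i)"
        unfolding sum_distrib_left
      proof (intro sum.cong refl)
        show "coeff P (n - i) * (d * u) ^ i = d * (coeff P (n - i) * d ^ (i - 1) * u ^ i)"
          if "i \<in> {1..n}" for i
          using that by (cases i) (auto simp: power_mult_distrib)
      qed
      also have "d + \<dots> = d * poly Z u"
        by (simp add: polyZ cofactor_poly_def d_def algebra_simps)
      finally have root: "poly P w = 0" using Z0 False u0 by simp
      obtain K where K: "P = [:1, - (1 / w):] * K" "coeff K 0 = 1" "degree K \<le> m"
        "\<And>z. norm z < 1 \<Longrightarrow> poly K z \<noteq> 0" "1 \<le> norm w"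
        using zero_free_poly_split[OF zf c0 _ root] deg unfolding m by metis
      have "d = coeff K (Suc m) - (1 / w) * coeff K m"
        unfolding d_def m by (subst K(1)) simp
      also have "coeff K (Suc m) = 0" using K(3) by (intro coeff_eq_0) auto
      finally have "d = - (d * u * coeff K m)" by (simp add: w_def)
      then have "norm d = norm (d * u) * norm (coeff K m)"
        by (metis norm_minus_cancel norm_mult)
      also have "\<dots> \<le> norm (d * u) * 1"
        using zero_free_poly_bounds(1)[OF K(4,2,3), of m] by (intro mult_left_mono) auto
      finally show False using u False by (simp add: norm_mult)
    qed
  qed
  ultimately show ?thesis
    using zero_free_poly_bounds(2)[of Z n v] v by (simp add: polyZ)
qed


section \<open>A maximum principle for cofactor products\<close>

text \<open>Zeros cannot enter through the circle, where the modulus stays above \<open>\<delta>\<close>.  For a given \<open>s\<close> without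
  zeros the minimum principle gives the bound \<open>\<delta>\<close> on the whole disc, so the parameters without zeros and
  those where the modulus drops to \<open>\<delta> / 2\<close> are two disjoint closed sets covering \<open>[0, 1]\<close>.\<close>

lemma zero_free_homotopy:
  fixes N :: "complex \<Rightarrow> real \<Rightarrow> complex"
  assumes cont: "continuous_on (cball 0 \<rho> \<times> {0..1}) (\<lambda>(z, s). N z s)"
    and hol: "\<And>s. s \<in> {0..1} \<Longrightarrow> (\<lambda>z. N z s) holomorphic_on ball 0 \<rho>"
    and rim: "\<And>z s. norm z = \<rho> \<Longrightarrow> s \<in> {0..1} \<Longrightarrow> \<delta> \<le> norm (N z s)"
    and pos: "0 < \<delta>" "0 < \<rho>"
    and start: "\<And>z. norm z \<le> \<rho> \<Longrightarrow> N z 0 \<noteq> 0"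
    and z: "norm z \<le> \<rho>"
  shows "N z 1 \<noteq> 0"
proof
  assume z0: "N z 1 = 0"
  have cont_z: "continuous_on (cball 0 \<rho>) (\<lambda>z. N z s)" if "s \<in> {0..1}" for s
  proof -
    have "continuous_on (cball 0 \<rho>) (\<lambda>z. (\<lambda>(z, s). N z s) (z, s))"
      by (rule continuous_on_compose2[OF cont]) (use that in \<open>auto intro!: continuous_intros\<close>)
    then show ?thesis by simp
  qed
  have cont_s: "continuous_on {0..1} (\<lambda>s. N z s)" if "z \<in> cball 0 \<rho>" for z
  proof -
    have "continuous_on {0..1} (\<lambda>s. (\<lambda>(z, s). N z s) (z, s))"
      by (rule continuous_on_compose2[OF cont]) (use that in \<open>auto intro!: continuous_intros\<close>)
    then show ?thesis by simp
  qed
  have dichotomy: "\<delta> \<le> norm (N z s)"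
    if s: "s \<in> {0..1}" and nz: "\<forall>u\<in>cball 0 \<rho>. N u s \<noteq> 0" and z: "z \<in> cball 0 \<rho>" for s z
  proof -
    have "norm (inverse (N z s)) \<le> 1 / \<delta>"
    proof (rule maximum_modulus_frontier[where S = "cball 0 \<rho>" and f = "\<lambda>z. inverse (N z s)"])
      show "(\<lambda>z. inverse (N z s)) holomorphic_on interior (cball 0 \<rho>)"
        using nz by (auto intro!: holomorphic_on_inverse hol s)
      show "continuous_on (closure (cball 0 \<rho>)) (\<lambda>z. inverse (N z s))"
        using nz by (auto intro!: continuous_on_inverse cont_z s)
      show "norm (inverse (N u s)) \<le> 1 / \<delta>" if "u \<in> frontier (cball 0 \<rho>)" for u
        using le_imp_inverse_le[OF rim[of u s] pos(1)] that s
          by (auto simp: norm_inverse simp flip: inverse_eq_divide)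
    qed (use z in auto)
    then have "inverse (norm (N z s)) \<le> inverse \<delta>"
      by (simp add: norm_inverse flip: inverse_eq_divide)
    then show ?thesis
      by (rule inverse_le_imp_le) (use nz z in auto)
  qed
  define S where "S = {s\<in>{0..1}. \<forall>u\<in>cball 0 \<rho>. \<delta> \<le> norm (N u s)}"
  define T where "T = (cball 0 \<rho> \<times> {0..1}) \<inter> (\<lambda>p. norm ((\<lambda>(z, s). N z s) p)) -` {..\<delta> / 2}"
  have "closed S"
  proof -
    have "S = {0..1} \<inter> (\<Inter>u\<in>cball 0 \<rho>. {0..1} \<inter> (\<lambda>s. norm (N u s)) -` {\<delta>..})"
      by (auto simp: S_def)
    then show ?thesis
      by (simp only:)
        (intro closed_Int closed_INT ballI continuous_closed_preimage continuous_on_norm cont_s; simp)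
  qed
  moreover have "closed (snd ` T)"
  proof -
    have "closed T"
      unfolding T_def
      by (intro continuous_closed_preimage continuous_on_norm cont closed_Times) auto
    then have "compact (cball 0 \<rho> \<times> {0..1} \<inter> T)"
      by (intro compact_Int_closed compact_Times) auto
    moreover have "cball 0 \<rho> \<times> {0..1} \<inter> T = T" by (auto simp: T_def)
    ultimately show ?thesis
      by (auto intro!: compact_imp_closed compact_continuous_image continuous_intros)
  qed
  moreover have "{0..1} \<subseteq> S \<union> snd ` T"
  proof
    fix s :: real
    assume s: "s \<in> {0..1}"
    show "s \<in> S \<union> snd ` T"
    proof (cases "\<forall>u\<in>cball 0 \<rho>. N u s \<noteq> 0")
      case True
      then show ?thesis using dichotomy s by (auto simp: S_def)
    next
      case False
      then obtain u where "u \<in> cball 0 \<rho>" "N u s = 0" by blast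
      then have "(u, s) \<in> T" using s pos by (auto simp: T_def)
      then show ?thesis by force
    qed
  qed
  moreover have "S \<inter> snd ` T \<inter> {0..1} = {}"
    using pos by (force simp: S_def T_def)
  moreover have "0 \<in> S"
    using dichotomy[of 0] start by (auto simp: S_def)
  moreover have "(z, 1) \<in> T" using z z0 pos by (auto simp: T_def)
  then have "1 \<in> snd ` T" by force
  ultimately show False
    using connected_Icc[of "0::real" 1] unfolding connected_closed
    by (metis (no_types, lifting) IntI atLeastAtMost_iff empty_iff order_refl zero_le_one)
qed

text \<open>The zeros of the cofactor polynomial are, up to sign, the \<open>1 / y\<^sub>i\<close>.  Since \<open>c\<^sub>n\<close> vanishes to second
  order and \<open>c\<^sub>n\<^sub>-\<^sub>1\<close>, \<open>c\<^sub>n\<^sub>-\<^sub>2\<close> to first order, substituting \<open>v = W / z\<close>, that is dividing all \<open>y\<^sub>i\<close> by \<open>z\<close>, leaves a function \<open>N\<close>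
  holomorphic in \<open>z\<close> with \<open>N(0, W) = 1 + a(0) W\<close> for \<open>a(0) = c\<^sub>n\<^sub>-\<^sub>1'(0)\<close>.  It has no zero for
  \<open>|W| < |z|\<close>, and by homotopy in \<open>W\<close> none for \<open>|W| < \<rho>\<close> and \<open>|z| \<le> \<rho> < 1\<close>; if \<open>|a(0)| > 1\<close>, then
  \<open>W = - 1 / a(0)\<close> contradicts this.\<close>

lemma cofactor_disc_bound:
  fixes c :: "nat \<Rightarrow> complex \<Rightarrow> complex"
  assumes hol: "\<And>j. j \<le> n \<Longrightarrow> c j holomorphic_on ball 0 1" and n: "n \<ge> 3"
    and zero: "c n 0 = 0" "c (n - 1) 0 = 0" "c (n - 2) 0 = 0" and dn: "deriv (c n) 0 = 0"
    and low: "\<And>z v. norm z < 1 \<Longrightarrow> norm v \<le> 1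
               \<Longrightarrow> (1 - norm v) ^ n \<le> norm (cofactor_poly n (\<lambda>j. c j z) v)"
  shows "norm (deriv (c (n - 1)) 0) \<le> 1"
proof (rule ccontr)
  obtain h where h: "h holomorphic_on ball 0 1" "\<And>z. norm z < 1 \<Longrightarrow> c n z = z * h z" "h 0 = 0"
    using Schwarz3[OF hol[of n] zero(1)] dn by (metis order_refl)
  obtain k where k: "k holomorphic_on ball 0 1" "\<And>z. norm z < 1 \<Longrightarrow> h z = z * k z"
    using Schwarz3[OF h(1,3)] by metis
  obtain a where a: "a holomorphic_on ball 0 1" "\<And>z. norm z < 1 \<Longrightarrow> c (n - 1) z = z * a z"
      "deriv (c (n - 1)) 0 = a 0"
    using Schwarz3[OF hol[of "n - 1"] zero(2)] by (metis diff_le_self)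
  obtain b where b: "b holomorphic_on ball 0 1" "\<And>z. norm z < 1 \<Longrightarrow> c (n - 2) z = z * b z"
    using Schwarz3[OF hol[of "n - 2"] zero(3)] by (metis diff_le_self)
  have cn: "c n z = z\<^sup>2 * k z" if "norm z < 1" for z
    using h(2)[OF that] k(2)[OF that] by (simp add: power2_eq_square)
  assume "\<not> norm (deriv (c (n - 1)) 0) \<le> 1"
  then have a1: "1 < norm (a 0)" using a(3) by simp
  define W where "W = - (1 / a 0)"
  have W: "norm W < 1" "1 + a 0 * W = 0"
    using a1 by (auto simp: W_def norm_divide divide_simps)
  define \<rho> where "\<rho> = (1 + norm W) / 2"
  have \<rho>: "norm W < \<rho>" "\<rho> < 1" "0 < \<rho>"
    using W(1) norm_ge_zero[of W] by (auto simp: \<rho>_def field_simps simp del: norm_ge_zero)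
  define N where "N = (\<lambda>z (s::real). 1 + a z * (s * W) + z * b z * k z * (s * W)\<^sup>2
      + (\<Sum>i=3..n. c (n - i) z * k z ^ (i - 1) * z ^ (i - 2) * (s * W) ^ i))"
  have NZ: "N z s = cofactor_poly n (\<lambda>j. c j z) (s * W / z)" if z: "norm z < 1" "z \<noteq> 0" for z s
  proof -
    have "{1..n} = insert 1 (insert 2 {3..n})" using n by auto
    then have split: "sum X {1..n} = X 1 + (X 2 + sum X {3..n})" for X :: "nat \<Rightarrow> complex"
      by simp
    have first: "c (n - 1) z * c n z ^ (1 - 1) * (s * W / z) ^ 1 = a z * (s * W)"
      unfolding a(2)[OF z(1)] using z(2) by simp
    have second: "c (n - 2) z * c n z ^ (2 - 1) * (s * W / z)\<^sup>2 = z * b z * k z * (s * W)\<^sup>2"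
      using z by (simp add: b(2) cn power_divide power2_eq_square)
    have "c (n - i) z * c n z ^ (i - 1) * (s * W / z) ^ i
        = c (n - i) z * k z ^ (i - 1) * z ^ (i - 2) * (s * W) ^ i" if "i \<in> {3..n}" for i
    proof -
      define m where "m = i - 2"
      have m: "i = m + 2" "i - 1 = m + 1" "i - 2 = m" using that by (auto simp: m_def)
      have "(z\<^sup>2) ^ (m + 1) = z ^ m * z ^ (m + 2)"
        by (simp add: power_mult_distrib power2_eq_square algebra_simps)
      then have *: "(z\<^sup>2 * k z) ^ (m + 1) * (s * W / z) ^ (m + 2)
          = k z ^ (m + 1) * z ^ m * (s * W) ^ (m + 2)"
        unfolding power_mult_distrib[of "z\<^sup>2"] power_divide using z(2) by simp
      have "c (n - i) z * c n z ^ (i - 1) * (s * W / z) ^ i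
          = c (n - i) z * ((z\<^sup>2 * k z) ^ (m + 1) * (s * W / z) ^ (m + 2))"
        unfolding m(2) cn[OF z(1)] by (simp only: m(1) mult.assoc)
      then show ?thesis
        unfolding * m(2,3) by (simp only: m(1) mult.assoc)
    qed
    then have tail: "(\<Sum>i=3..n. c (n - i) z * c n z ^ (i - 1) * (s * W / z) ^ i)
        = (\<Sum>i=3..n. c (n - i) z * k z ^ (i - 1) * z ^ (i - 2) * (s * W) ^ i)"
      by (rule sum.cong[OF refl])
    show ?thesis
      unfolding cofactor_poly_def N_def split first second tail by (simp only: add.assoc)
  qed
  have inb: "z \<in> ball 0 1" if "norm z \<le> \<rho>" for z :: complex using that \<rho> by simp
  have "N 0 1 \<noteq> 0"
  proof (rule zero_free_homotopy[where N = N and z = 0 and \<rho> = \<rho> and \<delta> = "(1 - norm W / \<rho>) ^ n"])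
    show "continuous_on (cball 0 \<rho> \<times> {0..1}) (\<lambda>(z, s). N z s)"
    proof -
      have *: "continuous_on (cball 0 \<rho> \<times> {0..1::real}) (\<lambda>p. f (fst p))"
        if "f holomorphic_on ball 0 1" for f :: "complex \<Rightarrow> complex"
        using holomorphic_on_imp_continuous_on[OF that]
        by (rule continuous_on_compose2) (use inb in \<open>auto intro!: continuous_intros\<close>)
      show ?thesis
        unfolding N_def case_prod_unfold
        by (intro continuous_intros * a b k hol) auto
    qed
    show "(\<lambda>z. N z s) holomorphic_on ball 0 \<rho>" for s
    proof -
      have "ball 0 \<rho> \<subseteq> ball (0::complex) 1" using \<rho> by auto
      then show ?thesis
        unfolding N_def
        by (intro holomorphic_intros holomorphic_on_subset[OF a(1)] holomorphic_on_subset[OF b(1)]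
            holomorphic_on_subset[OF k(1)] holomorphic_on_subset[OF hol]) auto
    qed
    show "(1 - norm W / \<rho>) ^ n \<le> norm (N z s)" if z: "norm z = \<rho>" and s: "s \<in> {0..1}" for z s
    proof -
      have z0: "z \<noteq> 0" "norm z < 1" using z \<rho> by auto
      have le: "norm (s * W / z) \<le> norm W / \<rho>"
        using s z \<rho> by (auto simp: norm_mult norm_divide divide_simps intro: mult_left_le_one_le)
      have "norm W / \<rho> < 1" using \<rho> by simp
      then have "(1 - norm W / \<rho>) ^ n \<le> (1 - norm (s * W / z)) ^ n"
        using le by (intro power_mono) auto
      also have "\<dots> \<le> norm (N z s)"
        unfolding NZ[OF z0(2,1)] using le \<open>norm W / \<rho> < 1\<close> z0 by (intro low) auto
      finally show ?thesis .
    qed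
    show "N z 0 \<noteq> 0" for z by (simp add: N_def power_0_left)
    show "0 < (1 - norm W / \<rho>) ^ n" using \<rho> by simp
  qed (use \<rho> in auto)
  moreover have "N 0 1 = 0"
    using W(2) by (simp add: N_def power_0_left)
  ultimately show False by simp
qed


section \<open>Limits of discs joining nearby polynomials\<close>

lemma Montel_finite_family:
  fixes F :: "nat \<Rightarrow> 'i \<Rightarrow> complex \<Rightarrow> complex"
  assumes "finite I"
    and hol: "\<And>m j. j \<in> I \<Longrightarrow> F m j holomorphic_on ball 0 1"
    and bnd: "\<And>m j z. j \<in> I \<Longrightarrow> norm z < 1 \<Longrightarrow> norm (F m j z) \<le> B"
  obtains g \<sigma> where "strict_mono (\<sigma> :: nat \<Rightarrow> nat)"
    "\<And>j. j \<in> I \<Longrightarrow> g j holomorphic_on ball 0 1"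
    "\<And>j K. j \<in> I \<Longrightarrow> compact K \<Longrightarrow> K \<subseteq> ball 0 1
       \<Longrightarrow> uniform_limit K (\<lambda>m. F (\<sigma> m) j) (g j) sequentially"
proof -
  have "\<exists>g \<sigma>. strict_mono (\<sigma> :: nat \<Rightarrow> nat) \<and> (\<forall>j\<in>I. g j holomorphic_on ball 0 1 \<and>
     (\<forall>K. compact K \<longrightarrow> K \<subseteq> ball 0 1 \<longrightarrow> uniform_limit K (\<lambda>m. F (\<sigma> m) j) (g j) sequentially))"
    using assms
  proof (induction I rule: finite_induct)
    case empty
    then show ?case using strict_mono_id by auto
  next
    case (insert i I)
    then obtain g \<sigma> where \<sigma>: "strict_mono (\<sigma> :: nat \<Rightarrow> nat)" and
      g: "\<And>j. j \<in> I \<Longrightarrow> g j holomorphic_on ball 0 1"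
      "\<And>j K. j \<in> I \<Longrightarrow> compact K \<Longrightarrow> K \<subseteq> ball 0 1
         \<Longrightarrow> uniform_limit K (\<lambda>m. F (\<sigma> m) j) (g j) sequentially"
      by (metis insert_iff)
    obtain f \<tau> where f: "f holomorphic_on ball 0 1" "strict_mono (\<tau> :: nat \<Rightarrow> nat)"
      "\<And>K. compact K \<Longrightarrow> K \<subseteq> ball 0 1
         \<Longrightarrow> uniform_limit K ((\<lambda>m. F (\<sigma> m) i) \<circ> \<tau>) f sequentially"
    proof (rule Montel[of "ball 0 1" "range (\<lambda>m. F (\<sigma> m) i)" "\<lambda>m. F (\<sigma> m) i"])
      show "\<exists>B. \<forall>h\<in>range (\<lambda>m. F (\<sigma> m) i). \<forall>z\<in>K. norm (h z) \<le> B" if "K \<subseteq> ball 0 1" for K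
        using insert.prems(2)[of i] that by (intro exI[of _ B]) fastforce
    qed (use insert.prems(1) in auto)
    have "uniform_limit K (\<lambda>m. F (\<sigma> (\<tau> m)) j) (g j) sequentially"
      if "j \<in> I" "compact K" "K \<subseteq> ball 0 1" for j K
      using filterlim_compose[OF g(2)[OF that] filterlim_subseq[OF f(2)]] by simp
    then show ?case
      using f g(1) insert.hyps(2) strict_mono_o[OF \<sigma> f(2)]
      by (intro exI[of _ "g(i := f)"] exI[of _ "\<sigma> \<circ> \<tau>"]) (auto simp: o_def)
  qed
  then show thesis using that by metis
qed

lemma Schwarz_quotient_bound:
  assumes hol: "f holomorphic_on ball 0 1" and "f 0 = 0"
    and bnd: "\<And>z. norm z < 1 \<Longrightarrow> norm (f z) < M"
  obtains h where "h holomorphic_on ball 0 1" "\<And>z. norm z < 1 \<Longrightarrow> f z = z * h z"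
    "\<And>z. norm z < 1 \<Longrightarrow> norm (h z) \<le> M"
proof -
  have M: "0 < M" using bnd[of 0] assms(2) by simp
  obtain h where h: "h holomorphic_on ball 0 1" "\<And>z. norm z < 1 \<Longrightarrow> f z = z * h z" "deriv f 0 = h 0"
    using Schwarz3[OF hol assms(2)] by metis
  define F where "F = (\<lambda>z. f z / of_real M)"
  have F: "F holomorphic_on ball 0 1" "F 0 = 0" "\<And>z. norm z < 1 \<Longrightarrow> norm (F z) < 1"
    using bnd M assms(2) unfolding F_def
    by (auto intro!: holomorphic_intros hol simp: norm_divide)
  have "norm (h z) \<le> M" if z: "norm z < 1" for z
  proof (cases "z = 0")
    case True
    have "(f has_field_derivative deriv f 0) (at 0)"
      by (rule holomorphic_derivI[OF hol]) auto
    then have "(F has_field_derivative deriv f 0 / of_real M) (at 0)"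
      unfolding F_def by (rule DERIV_cdivide)
    then have "deriv F 0 = deriv f 0 / of_real M" by (rule DERIV_imp_deriv)
    moreover have "norm (deriv F 0) \<le> 1" by (rule Schwarz_Lemma(2)[OF F z])
    ultimately show ?thesis using h(3) True M by (simp add: norm_divide)
  next
    case False
    have "norm (F z) \<le> norm z" by (rule Schwarz_Lemma(1)[OF F z])
    then have "norm z * norm (h z) \<le> norm z * M"
      using h(2)[OF z] M by (simp add: F_def norm_divide norm_mult divide_simps mult.commute)
    then show ?thesis using False by simp
  qed
  then show thesis using that h by blast
qed

text \<open>A holomorphic disc in the symmetrized polydisc, whose points are encoded as polynomials.\<close>

definition poly_disc :: "nat \<Rightarrow> (complex \<Rightarrow> complex poly) \<Rightarrow> bool" where
  "poly_disc n P \<longleftrightarrow> (\<forall>j. (\<lambda>z. coeff (P z) j) holomorphic_on ball 0 1) \<and>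
     (\<forall>z. norm z < 1 \<longrightarrow> degree (P z) \<le> n \<and> coeff (P z) 0 = 1 \<and>
        (\<forall>w. norm w \<le> 1 \<longrightarrow> poly (P z) w \<noteq> 0))"

lemma poly_discD:
  assumes "poly_disc n P"
  shows "(\<lambda>z. coeff (P z) j) holomorphic_on ball 0 1"
    and "norm z < 1 \<Longrightarrow> degree (P z) \<le> n"
    and "norm z < 1 \<Longrightarrow> coeff (P z) 0 = 1"
    and "norm z < 1 \<Longrightarrow> norm w \<le> 1 \<Longrightarrow> poly (P z) w \<noteq> 0"
  using assms by (auto simp: poly_disc_def)

text \<open>An infinitesimal version of \<open>cofactor_disc_bound\<close>, in which only the values at \<open>0\<close> and at a nearby
  point \<open>\<alpha>\<^sub>m\<close> are known.  Write the coefficients as \<open>c\<^sub>j(0) + z h\<^sub>j(z)\<close>.  The quotients \<open>h\<^sub>j\<close> are uniformly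
  bounded, so Montel's theorem applies to them rather than to the discs, and their limits at \<open>0\<close> are the
  derivatives of the limit disc.  As \<open>\<alpha>\<^sub>m\<close> may be much smaller than \<open>t\<^sub>m\<close>, the vanishing of the limit
  for \<open>j = n\<close> is read off from the ratio to \<open>j = n - 1\<close>, where \<open>\<alpha>\<^sub>m\<close> cancels.\<close>

lemma shrinking_discs_bound:
  fixes P :: "nat \<Rightarrow> complex \<Rightarrow> complex poly" and \<alpha> :: "nat \<Rightarrow> complex" and t :: "nat \<Rightarrow> real"
  assumes n: "n \<ge> 3"
    and disc: "\<And>m. poly_disc n (P m)"
    and \<alpha>: "\<And>m. norm (\<alpha> m) \<le> t m" "\<And>m. t m > 0" "t \<longlonglongrightarrow> 0" "\<And>m. norm (\<alpha> m) < 1"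
    and base: "\<And>j. (\<lambda>m. coeff (P m 0) j) \<longlonglongrightarrow> p j" "p n = 0" "p (n - 1) = 0" "p (n - 2) = 0"
    and lim_n: "(\<lambda>m. (coeff (P m (\<alpha> m)) n - coeff (P m 0) n) / t m) \<longlonglongrightarrow> 0"
    and lim_A: "(\<lambda>m. (coeff (P m (\<alpha> m)) (n - 1) - coeff (P m 0) (n - 1)) / t m) \<longlonglongrightarrow> A"
  shows "norm A \<le> 1"
proof (cases "A = 0")
  case False
  note hol = poly_discD(1)[OF disc] and deg = poly_discD(2)[OF disc]
    and c0 = poly_discD(3)[OF disc]
  have zf: "poly (P m z) w \<noteq> 0" if "norm z < 1" "norm w < 1" for m z w
    using poly_discD(4)[OF disc] that by simp
  define M where "M = 2 * 2 ^ n + (1::real)"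
  have cbd: "norm (coeff (P m z) j) \<le> 2 ^ n" if "norm z < 1" for m z j
  proof -
    have "norm (coeff (P m z) j) \<le> real (n choose j)"
      using that by (intro zero_free_poly_bounds(1) zf c0 deg)
    also have "\<dots> \<le> real (2 ^ n)" by (metis binomial_le_pow2 of_nat_le_iff)
    finally show ?thesis by simp
  qed
  have "\<exists>h. h holomorphic_on ball 0 1
        \<and> (\<forall>z. norm z < 1 \<longrightarrow> coeff (P m z) j - coeff (P m 0) j = z * h z)
        \<and> (\<forall>z. norm z < 1 \<longrightarrow> norm (h z) \<le> M)" for m j
  proof -
    have 1: "(\<lambda>z. coeff (P m z) j - coeff (P m 0) j) holomorphic_on ball 0 1"
      by (intro holomorphic_intros hol)
    have 2: "norm (coeff (P m z) j - coeff (P m 0) j) < M" if "norm z < 1" for z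
      using norm_triangle_ineq4[of "coeff (P m z) j" "coeff (P m 0) j"]
        cbd[OF that, of m j] cbd[of 0 m j] by (simp add: M_def)
    show ?thesis
      by (rule Schwarz_quotient_bound[OF 1 _ 2]) auto
  qed
  then obtain h where h: "\<And>m j. h m j holomorphic_on ball 0 1"
    "\<And>m j z. norm z < 1 \<Longrightarrow> coeff (P m z) j - coeff (P m 0) j = z * h m j z"
    "\<And>m j z. norm z < 1 \<Longrightarrow> norm (h m j z) \<le> M" by metis
  obtain g \<sigma> where \<sigma>: "strict_mono (\<sigma> :: nat \<Rightarrow> nat)"
    and g: "\<And>j. j \<in> {..n} \<Longrightarrow> g j holomorphic_on ball 0 1"
      "\<And>j K. j \<in> {..n} \<Longrightarrow> compact K \<Longrightarrow> K \<subseteq> ball 0 1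
         \<Longrightarrow> uniform_limit K (\<lambda>m. h (\<sigma> m) j) (g j) sequentially"
    by (rule Montel_finite_family[of "{..n}" h M]) (use h in auto)
  have sub: "(\<lambda>m. X (\<sigma> m)) \<longlonglongrightarrow> L" if "X \<longlonglongrightarrow> L" for X :: "nat \<Rightarrow> 'b::topological_space" and L
    using LIMSEQ_subseq_LIMSEQ[OF that \<sigma>] by (simp add: o_def)
  have \<alpha>0: "(\<lambda>m. \<alpha> (\<sigma> m)) \<longlonglongrightarrow> 0"
    by (rule Lim_null_comparison[OF _ sub[OF \<alpha>(3)]]) (simp add: \<alpha>)
  have h_lim: "(\<lambda>m. h (\<sigma> m) j (\<alpha> (\<sigma> m))) \<longlonglongrightarrow> g j 0" if j: "j \<le> n" for j
  proof -
    have "cball (0::complex) (1/2) \<subseteq> ball 0 1" by auto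
    then have U: "uniform_limit (cball 0 (1/2)) (\<lambda>m. h (\<sigma> m) j) (g j) sequentially"
      using g(2) j by auto
    have ev: "\<forall>\<^sub>F m in sequentially. \<alpha> (\<sigma> m) \<in> cball 0 (1/2)"
    proof -
      have "\<forall>\<^sub>F m in sequentially. dist (\<alpha> (\<sigma> m)) 0 < 1/2"
        using \<alpha>0 by (rule tendstoD) auto
      then show ?thesis by eventually_elim (auto simp: dist_commute)
    qed
    have "(\<lambda>m. h (\<sigma> m) j (\<alpha> (\<sigma> m)) - g j (\<alpha> (\<sigma> m))) \<longlonglongrightarrow> 0"
    proof (rule tendstoI)
      fix e :: real assume "e > 0"
      then have "\<forall>\<^sub>F m in sequentially. \<forall>z\<in>cball 0 (1/2). dist (h (\<sigma> m) j z) (g j z) < e"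
        using U by (simp add: uniform_limit_iff)
      then show "\<forall>\<^sub>F m in sequentially. dist (h (\<sigma> m) j (\<alpha> (\<sigma> m)) - g j (\<alpha> (\<sigma> m))) 0 < e"
        using ev by eventually_elim (auto simp: dist_norm)
    qed
    moreover have "(\<lambda>m. g j (\<alpha> (\<sigma> m))) \<longlonglongrightarrow> g j 0"
    proof -
      have "isCont (g j) 0"
        using holomorphic_on_imp_continuous_on[OF g(1)[of j]] j
        by (simp add: continuous_on_eq_continuous_at)
      then show ?thesis using \<alpha>0 by (rule isCont_tendsto_compose)
    qed
    ultimately show ?thesis using tendsto_add by fastforce
  qed
  define D where "D = (\<lambda>j m. (coeff (P m (\<alpha> m)) j - coeff (P m 0) j) / t m)"
  have D: "D j m * t m = \<alpha> m * h m j (\<alpha> m)" for j m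
    using h(2)[OF \<alpha>(4), of m m j] \<alpha>(2)[of m] by (simp add: D_def)
  have D_lim: "(\<lambda>m. D n (\<sigma> m)) \<longlonglongrightarrow> 0" "(\<lambda>m. D (n - 1) (\<sigma> m)) \<longlonglongrightarrow> A"
    using sub[OF lim_n] sub[OF lim_A] by (simp_all add: D_def)
  have "norm (D (n - 1) m) \<le> norm (h m (n - 1) (\<alpha> m))" for m
  proof -
    have "norm (D (n - 1) m) * t m = norm (\<alpha> m) * norm (h m (n - 1) (\<alpha> m))"
      using arg_cong[OF D[of "n - 1" m], of norm] \<alpha>(2)[of m] by (simp add: norm_mult)
    also have "\<dots> \<le> t m * norm (h m (n - 1) (\<alpha> m))"
      by (intro mult_right_mono \<alpha>) auto
    finally show ?thesis using \<alpha>(2)[of m] by (simp add: mult.commute)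
  qed
  then have A_le: "norm A \<le> norm (g (n - 1) 0)"
    by (intro LIMSEQ_le[OF tendsto_norm[OF D_lim(2)] tendsto_norm[OF h_lim[of "n - 1"]]]) auto
  have gn: "g n 0 = 0"
  proof -
    have "\<forall>\<^sub>F m in sequentially. D (n - 1) (\<sigma> m) \<noteq> 0"
      using D_lim(2) False by (rule tendsto_imp_eventually_ne)
    then have "\<forall>\<^sub>F m in sequentially.
        h (\<sigma> m) n (\<alpha> (\<sigma> m)) = D n (\<sigma> m) / D (n - 1) (\<sigma> m) * h (\<sigma> m) (n - 1) (\<alpha> (\<sigma> m))"
    proof eventually_elim
      case (elim m)
      let ?a = "\<alpha> (\<sigma> m)" and ?t = "complex_of_real (t (\<sigma> m))"
      have t0: "?t \<noteq> 0" using \<alpha>(2)[of "\<sigma> m"] by simp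
      have "?a \<noteq> 0" using D[of "n - 1" "\<sigma> m"] elim t0 by auto
      moreover have "?a * ?t * (h (\<sigma> m) n ?a * D (n - 1) (\<sigma> m))
          = ?a * ?t * (h (\<sigma> m) (n - 1) ?a * D n (\<sigma> m))"
        using D[of "n - 1" "\<sigma> m"] D[of n "\<sigma> m"] by (metis mult.assoc mult.commute)
      ultimately show ?case using elim t0 by (simp add: field_simps)
    qed
    moreover have "(\<lambda>m. D n (\<sigma> m) / D (n - 1) (\<sigma> m) * h (\<sigma> m) (n - 1) (\<alpha> (\<sigma> m)))
        \<longlonglongrightarrow> 0 / A * g (n - 1) 0"
      by (intro tendsto_intros D_lim False h_lim) auto
    ultimately have "(\<lambda>m. h (\<sigma> m) n (\<alpha> (\<sigma> m))) \<longlonglongrightarrow> 0"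
      using tendsto_cong by fastforce
    then show ?thesis using h_lim[of n] LIMSEQ_unique by blast
  qed
  define c where "c = (\<lambda>j z. p j + z * g j z)"
  have c_deriv: "deriv (c j) 0 = g j 0" if "j \<le> n" for j
  proof -
    have "(g j has_field_derivative deriv (g j) 0) (at 0)"
      by (rule holomorphic_derivI[OF g(1)]) (use that in auto)
    then have "(c j has_field_derivative g j 0) (at 0)"
      unfolding c_def by (auto intro!: derivative_eq_intros)
    then show ?thesis by (rule DERIV_imp_deriv)
  qed
  have c_lim: "(\<lambda>m. coeff (P (\<sigma> m) z) j) \<longlonglongrightarrow> c j z" if z: "norm z < 1" and j: "j \<le> n" for z j
  proof -
    have "(\<lambda>m. h (\<sigma> m) j z) \<longlonglongrightarrow> g j z"
      by (rule tendsto_uniform_limitI[OF g(2)[of j "{z}"]]) (use z j in auto)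
    then have "(\<lambda>m. coeff (P (\<sigma> m) 0) j + z * h (\<sigma> m) j z) \<longlonglongrightarrow> c j z"
      unfolding c_def by (intro tendsto_intros sub[OF base(1)])
    moreover have "coeff (P (\<sigma> m) 0) j + z * h (\<sigma> m) j z = coeff (P (\<sigma> m) z) j" for m
      using h(2)[OF z, of "\<sigma> m" j] by (simp add: algebra_simps)
    ultimately show ?thesis by simp
  qed
  have "norm (deriv (c (n - 1)) 0) \<le> 1"
  proof (rule cofactor_disc_bound[OF _ n])
    show "c j holomorphic_on ball 0 1" if "j \<le> n" for j
      unfolding c_def using that by (intro holomorphic_intros g(1)) auto
    show "c n 0 = 0" "c (n - 1) 0 = 0" "c (n - 2) 0 = 0"
      using base by (simp_all add: c_def)
    show "deriv (c n) 0 = 0" using gn c_deriv[of n] by simp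
    show "(1 - norm v) ^ n \<le> norm (cofactor_poly n (\<lambda>j. c j z) v)"
      if z: "norm z < 1" and v: "norm v \<le> 1" for z v
    proof (rule Lim_bounded2)
      show "(\<lambda>m. norm (cofactor_poly n (coeff (P (\<sigma> m) z)) v))
          \<longlonglongrightarrow> norm (cofactor_poly n (\<lambda>j. c j z) v)"
        unfolding cofactor_poly_def by (intro tendsto_intros c_lim z) auto
      show "\<forall>m\<ge>0. (1 - norm v) ^ n \<le> norm (cofactor_poly n (coeff (P (\<sigma> m) z)) v)"
        by (intro allI impI cofactor_poly_lower_bound zf c0 deg) (use n z v in auto)
    qed
  qed
  then show ?thesis using A_le c_deriv[of "n - 1"] by simp
qed simp


section \<open>A cubic disc that moves faster\<close>

text \<open>For \<open>e = 1\<close> and \<open>\<zeta> = t\<^sup>3\<close> this is \<open>\<Prod>(1 - B(s) w)\<close> over the three cube roots \<open>s\<close> of \<open>\<zeta>\<close>, with the Blaschke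
  product \<open>B(s) = s (1 + 2 s) / (2 + s)\<close>; for \<open>e = - 1\<close> all \<open>B(s)\<close> change sign.  The cube roots
  ramify totally at \<open>0\<close>, so the coefficient of \<open>w\<^sup>3\<close> has a nonzero derivative there, without which
  \<open>cofactor_disc_bound\<close> would exclude the derivative \<open>- 9/8\<close> of the coefficient of \<open>w\<^sup>2\<close>.  A Blaschke factor with zero \<open>- g\<close>, for \<open>0 < g < 1\<close>, gives the modulus
  \<open>3 g (1 - g\<^sup>2)\<close>, and \<open>g = 1/2\<close> is a rational choice for which it exceeds one.\<close>

definition cubic_disc :: "complex \<Rightarrow> complex \<Rightarrow> complex poly" where
  "cubic_disc e \<zeta> = [:1, e * 9 * \<zeta> / (8 + \<zeta>), - 9 * \<zeta> / (8 + \<zeta>), - e * (\<zeta> + 8 * \<zeta>\<^sup>2) / (8 + \<zeta>):]"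

lemma cubic_disc_denominator: "norm \<zeta> < 1 \<Longrightarrow> 8 + \<zeta> \<noteq> (0::complex)"
  using norm_minus_cancel[of \<zeta>] by (auto simp: add_eq_0_iff)

lemma cubic_disc_0 [simp]: "cubic_disc e 0 = 1"
  by (simp add: cubic_disc_def one_pCons)

lemma degree_cubic_disc: "degree (cubic_disc e \<zeta>) \<le> 3"
  by (simp add: cubic_disc_def)

text \<open>A zero would mean \<open>1 = u B(t)\<close>, but \<open>|B(t)| < 1\<close>.\<close>

lemma cubic_disc_factor_nonzero:
  fixes t u :: complex
  assumes t: "norm t < 1" and u: "norm u \<le> 1"
  shows "2 + (1 - u) * t - 2 * u * t\<^sup>2 \<noteq> 0"
proof
  assume "2 + (1 - u) * t - 2 * u * t\<^sup>2 = 0"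
  then have eq: "2 + t = u * (t * (1 + 2 * t))" by (simp add: algebra_simps power2_eq_square)
  have "(norm (2 + t))\<^sup>2 - (norm (1 + 2 * t))\<^sup>2 = 3 * (1 - (norm t)\<^sup>2)"
    unfolding cmod_power2 by (simp add: power2_eq_square algebra_simps)
  moreover have "(norm t)\<^sup>2 < 1" using t by (simp add: abs_square_less_1)
  ultimately have "(norm (1 + 2 * t))\<^sup>2 < (norm (2 + t))\<^sup>2" by simp
  then have less: "norm (1 + 2 * t) < norm (2 + t)" by (rule power2_less_imp_less) simp
  have "norm (2 + t) = norm u * (norm t * norm (1 + 2 * t))"
    by (metis eq norm_mult)
  also have "\<dots> \<le> 1 * (1 * norm (1 + 2 * t))"
    using t u by (intro mult_mono) auto
  finally show False using less by simp
qed

text \<open>The product over the three cube roots of \<open>t\<^sup>3\<close>, where \<open>\<omega>\<close> and \<open>\<omega>'\<close> are the two primitive cube roots of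
  unity: it only depends on \<open>t\<^sup>3\<close>.\<close>

lemma cube_root_factorisation:
  fixes t u \<omega> \<omega>' :: complex
  assumes sum: "\<omega> + \<omega>' = -1" and prod: "\<omega> * \<omega>' = 1"
  defines "f \<equiv> \<lambda>t. 2 + (1 - u) * t - 2 * u * t\<^sup>2"
  shows "f t * f (\<omega> * t) * f (\<omega>' * t)
    = 8 + t ^ 3 + 9 * t ^ 3 * u - 9 * t ^ 3 * u\<^sup>2 - (t ^ 3 + 8 * (t ^ 3)\<^sup>2) * u ^ 3"
proof -
  have "(2 + p * (\<omega> * t) + q * (\<omega> * t)\<^sup>2) * (2 + p * (\<omega>' * t) + q * (\<omega>' * t)\<^sup>2)
      = 4 + 2 * p * t * (\<omega> + \<omega>') + 2 * q * t\<^sup>2 * ((\<omega> + \<omega>')\<^sup>2 - 2 * (\<omega> * \<omega>'))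
        + p\<^sup>2 * t\<^sup>2 * (\<omega> * \<omega>') + p * q * t ^ 3 * (\<omega> * \<omega>') * (\<omega> + \<omega>')
        + q\<^sup>2 * t ^ 4 * (\<omega> * \<omega>')\<^sup>2" for p q
    by (simp add: algebra_simps power2_eq_square power3_eq_cube power4_eq_xxxx)
  from this[of "1 - u" "- 2 * u"]
  have "f (\<omega> * t) * f (\<omega>' * t) = 4 - 2 * (1 - u) * t + 4 * u * t\<^sup>2 + (1 - u)\<^sup>2 * t\<^sup>2
      + 2 * u * (1 - u) * t ^ 3 + 4 * u\<^sup>2 * t ^ 4"
    unfolding sum prod by (simp add: f_def power_mult_distrib)
  then have "f t * f (\<omega> * t) * f (\<omega>' * t) = f t * (4 - 2 * (1 - u) * t + 4 * u * t\<^sup>2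
      + (1 - u)\<^sup>2 * t\<^sup>2 + 2 * u * (1 - u) * t ^ 3 + 4 * u\<^sup>2 * t ^ 4)"
    by (simp add: mult.assoc)
  also have "\<dots> = 8 + t ^ 3 + 9 * t ^ 3 * u - 9 * t ^ 3 * u\<^sup>2 - (t ^ 3 + 8 * (t ^ 3)\<^sup>2) * u ^ 3"
    by (simp add: f_def algebra_simps power2_eq_square power3_eq_cube power4_eq_xxxx)
  finally show ?thesis .
qed

lemma cubic_disc_zero_free:
  assumes e: "e = 1 \<or> e = -1" and \<zeta>: "norm \<zeta> < 1" and w: "norm w \<le> 1"
  shows "poly (cubic_disc e \<zeta>) w \<noteq> 0"
proof -
  define u where "u = e * w"
  have u: "norm u \<le> 1" using e w by (auto simp: u_def)
  obtain t where t: "t ^ 3 = \<zeta>"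
  proof (cases "\<zeta> = 0")
    case True
    then show ?thesis using that[of 0] by simp
  next
    case False
    then have "exp (Ln \<zeta> / 3) ^ 3 = \<zeta>"
      by (simp flip: exp_of_nat_mult)
    then show ?thesis using that by blast
  qed
  have nt: "norm t < 1"
  proof (rule ccontr)
    assume "\<not> norm t < 1"
    then have "1 \<le> norm t ^ 3" by (intro one_le_power) auto
    then show False using t \<zeta> by (metis norm_power not_le)
  qed
  define \<omega> where "\<omega> = Complex (- 1 / 2) (sqrt 3 / 2)"
  have \<omega>: "\<omega>\<^sup>2 + \<omega> + 1 = 0"
    by (simp add: \<omega>_def complex_eq_iff power2_eq_square)
  then have \<omega>3: "\<omega> ^ 3 = 1" by algebra
  have n\<omega>: "norm \<omega> = 1"
    by (simp add: \<omega>_def cmod_def power_divide)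
  define f where "f = (\<lambda>t. 2 + (1 - u) * t - 2 * u * t\<^sup>2)"
  have "(8 + \<zeta>) * poly (cubic_disc e \<zeta>) w
      = 8 + \<zeta> + 9 * \<zeta> * u - 9 * \<zeta> * u\<^sup>2 - (\<zeta> + 8 * \<zeta>\<^sup>2) * u ^ 3"
  proof -
    define d where "d = 8 + \<zeta>"
    have "d \<noteq> 0" unfolding d_def by (rule cubic_disc_denominator[OF \<zeta>])
    then have "d * poly [:1, x / d, y / d, z / d:] w = d + x * w + y * w\<^sup>2 + z * w ^ 3" for x y z
      by (simp add: distrib_left power2_eq_square power3_eq_cube)
    then have "d * poly (cubic_disc e \<zeta>) w = d + e * 9 * \<zeta> * w + (- 9 * \<zeta>) * w\<^sup>2
        + (- e * (\<zeta> + 8 * \<zeta>\<^sup>2)) * w ^ 3"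
      unfolding cubic_disc_def d_def[symmetric] by blast
    then show ?thesis
      using e by (auto simp: u_def d_def power2_eq_square power3_eq_cube algebra_simps)
  qed
  also have "\<dots> = f t * f (\<omega> * t) * f (\<omega>\<^sup>2 * t)"
    unfolding f_def t[symmetric]
    by (rule cube_root_factorisation[symmetric]) (use \<omega> \<omega>3 in \<open>algebra+\<close>)
  finally have "(8 + \<zeta>) * poly (cubic_disc e \<zeta>) w = f t * f (\<omega> * t) * f (\<omega>\<^sup>2 * t)" .
  moreover have "f t \<noteq> 0" "f (\<omega> * t) \<noteq> 0" "f (\<omega>\<^sup>2 * t) \<noteq> 0"
    unfolding f_def
    by (rule cubic_disc_factor_nonzero; use nt u n\<omega> in \<open>simp add: norm_mult norm_power\<close>)+
  ultimately show ?thesis by auto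
qed

lemma coeff_cubic_mult:
  "coeff ([:a, x, y, z:] * v) j = a * coeff v j + x * coeff (pCons 0 v) j
     + y * coeff (pCons 0 (pCons 0 v)) j + z * coeff (pCons 0 (pCons 0 (pCons 0 v))) j"
  by (auto simp: coeff_pCons algebra_simps split: nat.split)

lemma poly_disc_cubic:
  assumes e: "e = 1 \<or> e = -1" and n: "n \<ge> 3" and v: "degree v \<le> n - 3" "coeff v 0 = 1"
    "\<And>w. norm w \<le> 1 \<Longrightarrow> poly v w \<noteq> 0"
  shows "poly_disc n (\<lambda>z. cubic_disc e z * v)"
  unfolding poly_disc_def
proof (intro conjI allI impI)
  show "(\<lambda>z. coeff (cubic_disc e z * v) j) holomorphic_on ball 0 1" for j
    unfolding cubic_disc_def coeff_cubic_mult
    by (intro holomorphic_intros) (auto dest: cubic_disc_denominator)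
  show "degree (cubic_disc e z * v) \<le> n" for z
    using degree_mult_le[of "cubic_disc e z" v] degree_cubic_disc[of e z] v(1) n by linarith
  show "coeff (cubic_disc e z * v) 0 = 1" for z
    using v(2) by (simp add: coeff_mult cubic_disc_def)
  show "poly (cubic_disc e z * v) w \<noteq> 0" if "norm z < 1" "norm w \<le> 1" for z w
    using cubic_disc_zero_free[OF e that] v(3)[OF that(2)] by simp
qed

text \<open>Otherwise there are such discs with \<open>|\<alpha>| < 2 \<tau>\<close> for a sequence of \<open>\<tau>\<close> tending to \<open>0\<close>.  The difference
  of the end points, divided by \<open>2 \<tau>\<close>, tends to \<open>- (9/8) w\<^sup>2 v(w)\<close>: the terms in \<open>w\<close> and \<open>w\<^sup>3\<close> cancel to first
  order.  Its coefficient of \<open>w\<^sup>n\<close> is zero and that of \<open>w\<^sup>n\<^sup>-\<^sup>1\<close> has modulus \<open>(9/8) b\<^sup>n\<^sup>-\<^sup>3 > 1\<close>,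
  against \<open>shrinking_discs_bound\<close>.\<close>

lemma exists_far_polynomials:
  fixes n :: nat
  assumes n: "n \<ge> 3"
  obtains v :: "complex poly" and \<tau> :: real
  where "0 < \<tau>" "\<tau> < 1 / 2" "degree v \<le> n - 3" "coeff v 0 = 1"
    "\<forall>w. norm w \<le> 1 \<longrightarrow> poly v w \<noteq> 0"
    "\<forall>P \<alpha>. poly_disc n P \<longrightarrow> P 0 = cubic_disc (-1) (- \<tau>) * v \<longrightarrow> P \<alpha> = cubic_disc 1 \<tau> * v
       \<longrightarrow> norm \<alpha> < 1 \<longrightarrow> 2 * \<tau> \<le> norm \<alpha>"
proof -
  define m where "m = n - 3"
  have nm: "n = m + 3" using n by (simp add: m_def)
  \<comment> \<open>By Bernoulli, \<open>b\<^sup>m \<ge> 9/10\<close>, which leaves \<open>(9/8) b\<^sup>m > 1\<close>.\<close>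
  define b :: real where "b = 1 - 1 / (10 * (real m + 1))"
  have b01: "0 < b" "b < 1" by (auto simp: b_def field_simps)
  have bm: "8 / 9 < b ^ m"
  proof -
    have "1 + real m * (b - 1) \<le> (1 + (b - 1)) ^ m"
      by (rule Bernoulli_inequality) (use b01 in auto)
    moreover have "- 1 / 10 \<le> real m * (b - 1)" by (simp add: b_def field_simps)
    ultimately show ?thesis by simp
  qed
  define v where "v = [:1, - complex_of_real b:] ^ m"
  have deg_v: "degree v \<le> m"
    unfolding v_def by (rule order_trans[OF degree_power_le]) simp
  have v0: "coeff v 0 = 1" by (simp add: v_def coeff_0_power)
  have v_zf: "poly v w \<noteq> 0" if w: "norm w \<le> 1" for w
  proof -
    have "norm w * b \<le> 1 * b" using w b01 by (intro mult_right_mono) auto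
    then have "norm w * b < 1" using b01 by linarith
    then have "norm (w * b) < 1" using b01 by (simp add: norm_mult)
    then have "1 - w * b \<noteq> 0" by auto
    then show ?thesis by (simp add: v_def poly_power)
  qed
  have v_top: "norm (coeff v m) = b ^ m"
  proof -
    have "degree v = m" unfolding v_def using b01 by (subst degree_power_eq) auto
    then have "coeff v m = lead_coeff v" by simp
    also have "\<dots> = (- complex_of_real b) ^ m"
      unfolding v_def using b01 by (simp add: lead_coeff_power)
    finally show ?thesis using b01 by (simp add: norm_power)
  qed
  define \<tau> where "\<tau> = (\<lambda>k::nat. 1 / (real k + 3))"
  have \<tau>: "0 < \<tau> k" "\<tau> k < 1 / 2" for k by (auto simp: \<tau>_def field_simps)
  have \<tau>0: "\<tau> \<longlonglongrightarrow> 0" unfolding \<tau>_def by real_asymp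
  have \<tau>c: "(\<lambda>k. complex_of_real (\<tau> k)) \<longlonglongrightarrow> 0"
    using tendsto_of_real[OF \<tau>0, where 'a = complex] by simp
  have "\<exists>k. \<forall>P \<alpha>. poly_disc n P \<longrightarrow> P 0 = cubic_disc (-1) (- \<tau> k) * v
      \<longrightarrow> P \<alpha> = cubic_disc 1 (\<tau> k) * v \<longrightarrow> norm \<alpha> < 1 \<longrightarrow> 2 * \<tau> k \<le> norm \<alpha>"
  proof (rule ccontr)
    assume "\<not> ?thesis"
    then have "\<forall>k. \<exists>P \<alpha>. poly_disc n P \<and> P 0 = cubic_disc (-1) (- \<tau> k) * v
        \<and> P \<alpha> = cubic_disc 1 (\<tau> k) * v \<and> norm \<alpha> < 1 \<and> norm \<alpha> < 2 * \<tau> k"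
      by (metis not_le)
    then obtain P \<alpha> where P: "\<And>k. poly_disc n (P k)"
       and P0: "\<And>k. P k 0 = cubic_disc (-1) (- \<tau> k) * v"
       and P\<alpha>: "\<And>k. P k (\<alpha> k) = cubic_disc 1 (\<tau> k) * v"
       and \<alpha>: "\<And>k. norm (\<alpha> k) < 1" "\<And>k. norm (\<alpha> k) < 2 * \<tau> k"
      by metis
    define D where "D = (\<lambda>j k. (coeff (P k (\<alpha> k)) j - coeff (P k 0) j) / complex_of_real (2 * \<tau> k))"
    have D_lim: "D j \<longlonglongrightarrow> - 9 / 8 * coeff (pCons 0 (pCons 0 v)) j" for j
    proof -
      define d where "d = (\<lambda>k. 64 - (complex_of_real (\<tau> k))\<^sup>2)"
      have "D j k = - 9 * complex_of_real (\<tau> k) / d k * coeff (pCons 0 v) j - 72 / d k * coeff (pCons 0 (pCons 0 v)) j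
          - 63 * complex_of_real (\<tau> k) / d k * coeff (pCons 0 (pCons 0 (pCons 0 v))) j" for k
      proof -
        have n8: "norm (complex_of_real (\<tau> k)) < 1" "norm (- complex_of_real (\<tau> k)) < 1"
          using \<tau>[of k] by auto
        have nz: "8 + complex_of_real (\<tau> k) \<noteq> 0" "8 - complex_of_real (\<tau> k) \<noteq> 0"
            "complex_of_real (\<tau> k) \<noteq> 0"
          using cubic_disc_denominator[OF n8(1)] cubic_disc_denominator[OF n8(2)] \<tau>(1)[of k] by auto
        have dk: "d k = (8 + complex_of_real (\<tau> k)) * (8 - complex_of_real (\<tau> k))"
          by (simp add: d_def algebra_simps power2_eq_square)
        show ?thesis
          unfolding D_def P0 P\<alpha> cubic_disc_def coeff_cubic_mult dk using nz
          by (simp add: divide_simps) (simp add: algebra_simps power2_eq_square)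
      qed
      then have "D j = (\<lambda>k. - 9 * complex_of_real (\<tau> k) / d k * coeff (pCons 0 v) j
          - 72 / d k * coeff (pCons 0 (pCons 0 v)) j
          - 63 * complex_of_real (\<tau> k) / d k * coeff (pCons 0 (pCons 0 (pCons 0 v))) j)" by auto
      moreover have "\<dots> \<longlonglongrightarrow> - 9 * 0 / (64 - 0\<^sup>2) * coeff (pCons 0 v) j
          - 72 / (64 - 0\<^sup>2) * coeff (pCons 0 (pCons 0 v)) j
          - 63 * 0 / (64 - 0\<^sup>2) * coeff (pCons 0 (pCons 0 (pCons 0 v))) j"
        unfolding d_def by (intro tendsto_intros \<tau>c) auto
      ultimately show ?thesis by simp
    qed
    have "norm (- 9 / 8 * coeff v m) \<le> 1"
    proof (rule shrinking_discs_bound[where P = P and \<alpha> = \<alpha> and t = "\<lambda>k. 2 * \<tau> k" and n = n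
          and p = "coeff v"])
      show "norm (\<alpha> k) \<le> 2 * \<tau> k" "0 < 2 * \<tau> k" "norm (\<alpha> k) < 1" for k
        using \<alpha>[of k] \<tau>[of k] by auto
      show "(\<lambda>k. 2 * \<tau> k) \<longlonglongrightarrow> 0" using tendsto_mult_right_zero[OF \<tau>0] .
      show "(\<lambda>k. coeff (P k 0) j) \<longlonglongrightarrow> coeff v j" for j
        unfolding P0 cubic_disc_def coeff_cubic_mult
        by (rule tendsto_eq_intros \<tau>0 refl | simp)+
      show "coeff v n = 0" "coeff v (n - 1) = 0" "coeff v (n - 2) = 0"
        using deg_v by (auto intro!: coeff_eq_0 simp: nm)
      have "D n \<longlonglongrightarrow> 0"
        using D_lim[of n] coeff_eq_0[of v "Suc m"] deg_v by (simp add: nm numeral_3_eq_3)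
      then show "(\<lambda>k. (coeff (P k (\<alpha> k)) n - coeff (P k 0) n) / complex_of_real (2 * \<tau> k)) \<longlonglongrightarrow> 0"
        by (simp add: D_def)
      have "D (n - 1) \<longlonglongrightarrow> - 9 / 8 * coeff v m"
        using D_lim[of "n - 1"] by (simp add: nm numeral_3_eq_3)
      then show "(\<lambda>k. (coeff (P k (\<alpha> k)) (n - 1) - coeff (P k 0) (n - 1))
          / complex_of_real (2 * \<tau> k)) \<longlonglongrightarrow> - 9 / 8 * coeff v m"
        by (simp add: D_def)
    qed (use n P in auto)
    then show False using v_top bm by (simp add: norm_mult)
  qed
  then show thesis
    using that \<tau> deg_v v0 v_zf unfolding m_def by blast
qed


section \<open>The Poincare distance\<close>

lemma artanh_real_strict_mono:
  fixes x y :: real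
  assumes "-1 < x" "x < y" "y < 1"
  shows "artanh x < artanh y"
proof -
  have "(1 + x) / (1 - x) < (1 + y) / (1 - y)"
    using assms by (intro frac_less) auto
  moreover have "0 < (1 + x) / (1 - x)" using assms by simp
  ultimately have "ln ((1 + x) / (1 - x)) < ln ((1 + y) / (1 - y))"
    by (intro ln_less_cancel_iff[THEN iffD2]) auto
  then show ?thesis by (simp add: artanh_def)
qed

lemma artanh_real_mono:
  fixes x y :: real
  assumes "-1 < x" "x \<le> y" "y < 1"
  shows "artanh x \<le> artanh y"
  using assms artanh_real_strict_mono[of x y] by (cases "x = y") auto

lemma artanh_real_add:
  fixes x y :: real
  assumes x: "\<bar>x\<bar> < 1" and y: "\<bar>y\<bar> < 1"
  shows "artanh x + artanh y = artanh ((x + y) / (1 + x * y))"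
proof -
  have "\<bar>x * y\<bar> < 1" using x y abs_mult_less[of x 1 y 1] by (simp add: abs_mult)
  then have xy: "1 + x * y > 0" by auto
  have "(1 + (x + y) / (1 + x * y)) / (1 - (x + y) / (1 + x * y))
      = ((1 + x) / (1 - x)) * ((1 + y) / (1 - y))"
  proof -
    have "1 + (x + y) / (1 + x * y) = (1 + x) * (1 + y) / (1 + x * y)"
      "1 - (x + y) / (1 + x * y) = (1 - x) * (1 - y) / (1 + x * y)"
      using xy by (simp_all add: field_simps)
    then show ?thesis using xy by simp
  qed
  moreover have "0 < (1 + x) / (1 - x)" "0 < (1 + y) / (1 - y)" using x y by auto
  ultimately show ?thesis
    by (simp only: artanh_def ln_mult_pos add_divide_distrib)
qed

text \<open>The triangle inequality for the path from \<open>u\<close> through \<open>0\<close> to \<open>w\<close>: the right-hand side is the addition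
  formula of \<open>tanh\<close>.  It follows from \<open>1 - |M|\<^sup>2 = (1 - |u|\<^sup>2) (1 - |w|\<^sup>2) / |1 - cnj w u|\<^sup>2\<close>, where \<open>M\<close>
  is the Moebius quotient, and \<open>|1 - cnj w u| \<le> 1 + |u| |w|\<close>.\<close>

lemma pseudohyperbolic_triangle_0:
  assumes u: "norm u < 1" and w: "norm w < 1"
  shows "norm (Moebius_function 0 w u) \<le> (norm u + norm w) / (1 + norm u * norm w)"
proof -
  let ?x = "norm u" and ?y = "norm w" and ?M = "norm (1 - cnj w * u)"
  have xy: "?x * ?y < 1" using u w norm_mult_less[of u 1 w 1] by (simp add: norm_mult)
  have id: "?M\<^sup>2 - (norm (u - w))\<^sup>2 = (1 - ?x\<^sup>2) * (1 - ?y\<^sup>2)"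
    unfolding cmod_power2 by (simp add: power2_eq_square algebra_simps)
  have "1 - ?x * ?y \<le> ?M"
    using norm_triangle_ineq2[of 1 "cnj w * u"] by (simp add: norm_mult mult.commute)
  then have M: "0 < ?M" using xy by linarith
  have M_le: "?M \<le> 1 + ?x * ?y"
    using norm_triangle_ineq4[of 1 "cnj w * u"] by (simp add: norm_mult mult.commute)
  have "(norm (u - w) / ?M)\<^sup>2 = 1 - (1 - ?x\<^sup>2) * (1 - ?y\<^sup>2) / ?M\<^sup>2"
    using id M by (simp add: field_simps)
  also have "\<dots> \<le> 1 - (1 - ?x\<^sup>2) * (1 - ?y\<^sup>2) / (1 + ?x * ?y)\<^sup>2"
  proof -
    have "0 \<le> (1 - ?x\<^sup>2) * (1 - ?y\<^sup>2)"
      using u w by (intro mult_nonneg_nonneg) (auto simp: power_le_one)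
    then show ?thesis
      using M M_le by (intro diff_left_mono divide_left_mono power_mono mult_pos_pos) auto
  qed
  also have "\<dots> = ((?x + ?y) / (1 + ?x * ?y))\<^sup>2"
  proof -
    have "1 + ?x * ?y > 0" by (simp add: add_pos_nonneg)
    then show ?thesis by (simp add: field_simps) (simp add: power2_eq_square algebra_simps)
  qed
  finally have "norm (u - w) / ?M \<le> (?x + ?y) / (1 + ?x * ?y)"
    by (rule power2_le_imp_le) auto
  then show ?thesis by (simp add: Moebius_function_simple norm_divide)
qed

lemma disc_denominator_nonzero:
  assumes "norm a < 1" "norm b < 1"
  shows "1 - cnj b * a \<noteq> 0"
proof -
  have "norm (cnj b * a) < 1"
    using assms norm_mult_less[of "cnj b" 1 a 1] by simp
  then show ?thesis by auto
qed

text \<open>The Moebius transformation that moves \<open>b\<close> to \<open>0\<close> is an isometry; this reduces the triangle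
  inequality to paths through \<open>0\<close>.\<close>

lemma pseudohyperbolic_invariant:
  assumes a: "norm a < 1" and b: "norm b < 1" and c: "norm c < 1"
  shows "norm (Moebius_function 0 (Moebius_function 0 b c) (Moebius_function 0 b a))
    = norm (Moebius_function 0 c a)"
proof -
  define p q where "p = 1 - cnj b * a" and "q = 1 - cnj b * c"
  have nz: "p \<noteq> 0" "q \<noteq> 0" "1 - cnj b * b \<noteq> 0"
    unfolding p_def q_def using assms by (intro disc_denominator_nonzero; simp)+
  then have "cnj q \<noteq> 0" by simp
  note nz = nz this
  have 1: "(a - b) / p - (c - b) / q = (a - c) * (1 - cnj b * b) / (p * q)"
    using nz by (simp add: field_simps) (simp add: p_def q_def algebra_simps)
  have 2: "1 - cnj ((c - b) / q) * ((a - b) / p) = (1 - cnj c * a) * (1 - cnj b * b) / (p * cnj q)"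
    using nz by (simp add: field_simps) (simp add: p_def q_def algebra_simps)
  have "norm (((a - b) / p - (c - b) / q) / (1 - cnj ((c - b) / q) * ((a - b) / p)))
      = norm ((a - c) / (1 - cnj c * a))"
    unfolding 1 2 using nz by (simp add: norm_mult norm_divide)
  then show ?thesis by (simp add: Moebius_function_simple p_def q_def)
qed

lemma poincare_dist_Moebius: "poincare_dist a b = artanh (norm (Moebius_function 0 b a))"
  by (simp add: poincare_dist_def Moebius_function_simple)

lemma norm_Moebius_commute: "norm (Moebius_function 0 b a) = norm (Moebius_function 0 a b)"
proof -
  have "norm (1 - cnj b * a) = norm (cnj (1 - cnj b * a))" by (simp only: complex_mod_cnj)
  also have "cnj (1 - cnj b * a) = 1 - cnj a * b" by (simp add: mult.commute)
  finally have "norm (1 - cnj b * a) = norm (1 - cnj a * b)" .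
  then show ?thesis
    by (simp add: Moebius_function_simple norm_divide norm_minus_commute)
qed

lemma poincare_dist_triangle:
  assumes a: "norm a < 1" and b: "norm b < 1" and c: "norm c < 1"
  shows "poincare_dist a c \<le> poincare_dist a b + poincare_dist b c"
proof -
  define u w where "u = Moebius_function 0 b a" and "w = Moebius_function 0 b c"
  have u: "norm u < 1" and w: "norm w < 1"
    unfolding u_def w_def using assms by (auto intro: Moebius_function_norm_lt_1)
  have "norm (Moebius_function 0 c a) = norm (Moebius_function 0 w u)"
    unfolding u_def w_def using pseudohyperbolic_invariant[OF a b c] by simp
  then have "norm (Moebius_function 0 c a) \<le> (norm u + norm w) / (1 + norm u * norm w)"
    using pseudohyperbolic_triangle_0[OF u w] by simp
  moreover have "(norm u + norm w) / (1 + norm u * norm w) < 1"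
  proof -
    have "0 < (1 - norm u) * (1 - norm w)" using u w by simp
    then show ?thesis by (simp add: divide_simps algebra_simps add_pos_nonneg)
  qed
  ultimately have "poincare_dist a c \<le> artanh ((norm u + norm w) / (1 + norm u * norm w))"
    unfolding poincare_dist_Moebius
    by (intro artanh_real_mono) (auto intro: less_le_trans[of _ 0])
  also have "\<dots> = artanh (norm u) + artanh (norm w)"
    using u w by (intro artanh_real_add[symmetric]) auto
  finally show ?thesis
    unfolding poincare_dist_Moebius u_def w_def by (simp add: norm_Moebius_commute[of c b])
qed

lemma caratheodory_triangle:
  assumes "p \<in> D" "o' \<in> D" "q \<in> D"
  shows "caratheodory D p q \<le> caratheodory D p o' + caratheodory D o' q"
proof -
  have "ereal (poincare_dist (f p) (f q)) \<le> caratheodory D p o' + caratheodory D o' q"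
    if f: "holomorphic_fun_on f D" "f ` D \<subseteq> ball 0 1" for f
  proof -
    have "ereal (poincare_dist (f p) (f q))
        \<le> ereal (poincare_dist (f p) (f o')) + ereal (poincare_dist (f o') (f q))"
      using f assms by (auto intro!: poincare_dist_triangle simp: image_subset_iff)
    also have "\<dots> \<le> caratheodory D p o' + caratheodory D o' q"
      unfolding caratheodory_def using f by (intro add_mono Sup_upper) auto
    finally show ?thesis .
  qed
  then show ?thesis
    unfolding caratheodory_def[of D p q] by (auto intro!: Sup_least)
qed


section \<open>The slice of the tetrablock along one variable\<close>

lemma bij_position: "bij_betw (position :: 'N::{finite,linorder} \<Rightarrow> nat) UNIV {1..CARD('N)}"
proof -
  have less: "position i < position j" if "i < j" for i j :: 'N
  proof -
    have "{k. k \<le> i} \<subseteq> {k. k \<le> j}" "j \<in> {k. k \<le> j} - {k. k \<le> i}" using that by auto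
    then show ?thesis unfolding position_def by (intro psubset_card_mono) auto
  qed
  have "inj (position :: 'N \<Rightarrow> nat)"
    by (rule injI) (metis less less_irrefl neqE)
  moreover have "range (position :: 'N \<Rightarrow> nat) = {1..CARD('N)}"
  proof (rule card_subset_eq)
    show "range (position :: 'N \<Rightarrow> nat) \<subseteq> {1..CARD('N)}"
      by (auto simp: position_def Suc_le_eq card_gt_0_iff intro!: card_mono)
    show "card (range (position :: 'N \<Rightarrow> nat)) = card {1..CARD('N)}"
      using card_image[OF \<open>inj position\<close>] by simp
  qed auto
  ultimately show ?thesis by (simp add: bij_betw_def)
qed

definition axis_index :: "nat \<Rightarrow> nat \<Rightarrow> nat \<Rightarrow> (nat \<Rightarrow> nat)" where
  "axis_index s J k = (\<lambda>j\<in>{1..s}. if j = J then k else 0)"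

text \<open>The tetrablock is sliced along \<open>z\<^sub>J\<close>.  The enumeration \<open>index\<close> is a parameter, although determined by
  the others, so that the coordinate type \<open>'N\<close> is fixed in the locale.\<close>

locale tetrablock_axis =
  fixes s :: nat and r :: "nat \<Rightarrow> nat" and J :: nat and index :: "'N::{finite,linorder} \<Rightarrow> nat \<Rightarrow> nat"
  assumes J: "J \<in> {1..s}" and N_card: "CARD('N) = (\<Prod>j=1..s. (r j + 1)) - 1"
  defines "index \<equiv> \<lambda>i. nth_multi_index s r (position i)"
begin

lemma bij_index: "bij_betw index UNIV (multi_indices s r)"
proof -
  have "bij_betw (nth_multi_index s r \<circ> position) (UNIV :: 'N set) (multi_indices s r)"
    using bij_position[where 'N = 'N] nth_multi_index_bij(1)[of s r]
    by (intro bij_betw_trans) (simp_all add: card_multi_indices N_card)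
  then show ?thesis by (simp add: index_def o_def)
qed

definition coord :: "nat \<Rightarrow> 'N" where
  "coord k = (SOME i. index i = axis_index s J k)"

lemma index_coord:
  assumes "k \<in> {1..r J}"
  shows "index (coord k) = axis_index s J k"
proof -
  have "axis_index s J k \<in> multi_indices s r"
  proof -
    have "axis_index s J k J \<noteq> (\<lambda>j\<in>{1..s}. 0) J" using assms J by (simp add: axis_index_def)
    then have "axis_index s J k \<noteq> (\<lambda>j\<in>{1..s}. 0)" by metis
    moreover have "axis_index s J k \<in> (\<Pi>\<^sub>E j\<in>{1..s}. {0..r j})"
      using assms by (auto simp: axis_index_def)
    ultimately show ?thesis by (simp add: multi_indices_def)
  qed
  then obtain i where "index i = axis_index s J k"
    using bij_index by (metis bij_betw_imp_surj_on imageE)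
  then show ?thesis unfolding coord_def by (rule someI)
qed

lemma axis_index_J: "axis_index s J k J = k"
  using J by (simp add: axis_index_def)

lemma inj_coord: "inj_on coord {1..r J}"
  by (rule inj_onI) (metis index_coord axis_index_J)

lemma axis_index_sum: "(\<Sum>j=1..s. axis_index s J k j) = k"
  using J by (simp add: axis_index_def)

lemma axis_index_prod: "(\<Prod>j=1..s. z j ^ axis_index s J k j) = (z J ^ k :: complex)"
proof -
  have "(\<Prod>j=1..s. z j ^ axis_index s J k j) = (\<Prod>j=1..s. if j = J then z j ^ k else 1)"
    by (intro prod.cong) (auto simp: axis_index_def)
  then show ?thesis using J by simp
qed

lemma R_poly_index:
  "R_poly s r x z = 1 + (\<Sum>i\<in>UNIV. (-1) ^ (\<Sum>j=1..s. index i j) * x $ i * (\<Prod>j=1..s. z j ^ index i j))"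
  for x :: "(complex, 'N) vec"
  by (simp add: R_poly_def index_def Let_def)

text \<open>The inclusion of the slice, and below the retraction \<open>axis_poly\<close> onto it: the sign \<open>(-1)\<^sup>k\<close> is that of the
  monomial \<open>z\<^sub>J\<^sup>k\<close> in \<open>R\<^sub>x\<close>, so that \<open>R\<^sub>x\<close> for \<open>x = axis_point P\<close> is \<open>P(z\<^sub>J)\<close>.\<close>

definition axis_point :: "complex poly \<Rightarrow> (complex, 'N) vec" where
  "axis_point P = (\<chi> i. \<Sum>k=1..r J. if i = coord k then (-1) ^ k * coeff P k else 0)"

definition axis_poly :: "(complex, 'N) vec \<Rightarrow> complex poly" where
  "axis_poly x = 1 + (\<Sum>k=1..r J. monom ((-1) ^ k * x $ coord k) k)"

lemma R_poly_axis_point: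
  assumes "degree P \<le> r J" "coeff P 0 = 1"
  shows "R_poly s r (axis_point P) z = poly P (z J)"
proof -
  have "(-1) ^ (\<Sum>j=1..s. index i j) * axis_point P $ i * (\<Prod>j=1..s. z j ^ index i j)
      = (\<Sum>k=1..r J. if i = coord k then coeff P k * z J ^ k else 0)" for i
  proof -
    have "(-1) ^ (\<Sum>j=1..s. index i j) * (if i = coord k then (-1) ^ k * coeff P k else 0)
        * (\<Prod>j=1..s. z j ^ index i j) = (if i = coord k then coeff P k * z J ^ k else 0)"
      if "k \<in> {1..r J}" for k
    proof (cases "i = coord k")
      case True
      have "(-1) ^ k * ((-1) ^ k * coeff P k) * z J ^ k = coeff P k * z J ^ k"
        by (simp flip: mult.assoc power_mult_distrib)
      then show ?thesis
        using True
        by (simp only: index_coord[OF that] axis_index_sum axis_index_prod if_True simp_thms)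
    qed simp
    then show ?thesis
      unfolding axis_point_def by (simp add: sum_distrib_left sum_distrib_right)
  qed
  then have "R_poly s r (axis_point P) z
      = 1 + (\<Sum>i\<in>UNIV. \<Sum>k=1..r J. if i = coord k then coeff P k * z J ^ k else 0)"
    unfolding R_poly_index by simp
  also have "\<dots> = 1 + (\<Sum>k=1..r J. coeff P k * z J ^ k)"
    by (subst sum.swap) (simp add: sum.delta)
  also have "\<dots> = (\<Sum>k\<le>r J. coeff P k * z J ^ k)"
    using assms(2) by (simp add: atMost_atLeast0 sum.atLeast_Suc_atMost)
  also have "\<dots> = poly P (z J)"
    unfolding poly_altdef using assms(1)
    by (intro sum.mono_neutral_right) (auto simp: coeff_eq_0)
  finally show ?thesis .
qed

text \<open>Every monomial that involves a variable other than \<open>z\<^sub>J\<close> vanishes at these points.\<close>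

lemma poly_axis_poly: "poly (axis_poly x) w = R_poly s r x (\<lambda>j. if j = J then w else 0)"
proof -
  define T where "T = (\<lambda>i. (-1) ^ (\<Sum>j=1..s. index i j) * x $ i
      * (\<Prod>j=1..s. (if j = J then w else 0) ^ index i j))"
  have T0: "T i = 0" if "i \<notin> coord ` {1..r J}" for i
  proof -
    have mi: "index i \<in> multi_indices s r" using bij_index by (auto simp: bij_betw_def)
    have "\<exists>j\<in>{1..s}. j \<noteq> J \<and> index i j \<noteq> 0"
    proof (rule ccontr)
      assume "\<not> ?thesis"
      then have zero: "\<And>j. j \<in> {1..s} \<Longrightarrow> j \<noteq> J \<Longrightarrow> index i j = 0" by blast
      have ext: "index i \<in> extensional {1..s}" using mi by (auto simp: multi_indices_def PiE_def)
      have eq: "index i = axis_index s J (index i J)"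
        by (rule extensionalityI[OF ext]) (use zero in \<open>auto simp: axis_index_def\<close>)
      have "index i J \<noteq> 0"
      proof
        assume "index i J = 0"
        then have "index i = (\<lambda>j\<in>{1..s}. 0)"
          by (subst eq) (auto simp: axis_index_def)
        then show False using mi by (simp add: multi_indices_def)
      qed
      moreover have "index i J \<le> r J" using mi J by (auto simp: multi_indices_def)
      ultimately have k: "index i J \<in> {1..r J}" by simp
      have "index i = index (coord (index i J))"
        using index_coord[OF k] eq by simp
      then have "i = coord (index i J)"
        using bij_index by (auto simp: bij_betw_def inj_def)
      then show False using that k by blast
    qed
    then obtain j where "j \<in> {1..s}" "j \<noteq> J" "index i j \<noteq> 0" by blast
    then have "(\<Prod>j=1..s. (if j = J then w else 0) ^ index i j) = 0"
      by (intro prod_zero) auto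
    then show ?thesis by (simp add: T_def)
  qed
  have "R_poly s r x (\<lambda>j. if j = J then w else 0) = 1 + sum T UNIV"
    unfolding R_poly_index T_def ..
  also have "sum T UNIV = sum T (coord ` {1..r J})"
    using T0 by (intro sum.mono_neutral_right) auto
  also have "\<dots> = (\<Sum>k=1..r J. T (coord k))"
    by (rule sum.reindex[OF inj_coord, unfolded o_def])
  also have "\<dots> = (\<Sum>k=1..r J. (-1) ^ k * x $ coord k * w ^ k)"
  proof (intro sum.cong refl)
    show "T (coord k) = (-1) ^ k * x $ coord k * w ^ k" if "k \<in> {1..r J}" for k
      unfolding T_def index_coord[OF that] axis_index_sum axis_index_prod by simp
  qed
  finally show ?thesis by (simp add: axis_poly_def poly_sum poly_monom)
qed

lemma coeff_axis_poly:
  "coeff (axis_poly x) j = (if j = 0 then 1 else if j \<le> r J then (-1) ^ j * x $ coord j else 0)"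
  by (auto simp: axis_poly_def coeff_sum)

lemma degree_axis_poly: "degree (axis_poly x) \<le> r J"
  by (rule degree_le) (auto simp: coeff_axis_poly)

lemma axis_poly_axis_point:
  assumes "degree P \<le> r J" "coeff P 0 = 1"
  shows "axis_poly (axis_point P) = P"
proof (rule poly_eqI)
  fix j
  show "coeff (axis_poly (axis_point P)) j = coeff P j"
  proof (cases "j \<in> {1..r J}")
    case True
    have "axis_point P $ coord j = (\<Sum>k=1..r J. if k = j then (-1) ^ k * coeff P k else 0)"
      unfolding axis_point_def vec_lambda_beta using inj_on_eq_iff[OF inj_coord True]
      by (intro sum.cong refl) auto
    then have "axis_point P $ coord j = (-1) ^ j * coeff P j" using True by simp
    moreover have "(-1) ^ j * ((-1) ^ j * coeff P j) = coeff P j"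
      by (simp flip: mult.assoc power_mult_distrib)
    ultimately show ?thesis using True by (simp add: coeff_axis_poly)
  next
    case False
    then show ?thesis using assms by (auto simp: coeff_axis_poly coeff_eq_0 not_le Suc_le_eq)
  qed
qed

abbreviation "E \<equiv> gen_tetrablock s r :: (complex, 'N) vec set"

lemma axis_point_in_tetrablock:
  assumes "degree P \<le> r J" "coeff P 0 = 1" "\<And>w. norm w \<le> 1 \<Longrightarrow> poly P w \<noteq> 0"
  shows "axis_point P \<in> E"
  using assms J by (auto simp: gen_tetrablock_def R_poly_axis_point)

lemma axis_poly_zero_free:
  assumes "x \<in> E" "norm w \<le> 1"
  shows "poly (axis_poly x) w \<noteq> 0"
  using assms unfolding poly_axis_poly gen_tetrablock_def by auto

lemma lempert_le_axis_disc:
  assumes disc: "poly_disc (r J) P" and ab: "norm a < 1" "norm b < 1"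
  shows "lempert E (axis_point (P a)) (axis_point (P b)) \<le> ereal (poincare_dist a b)"
proof -
  have "holomorphic_curve_on (\<lambda>z. axis_point (P z)) (ball 0 1)"
    unfolding holomorphic_curve_on_def
  proof
    fix i
    have "(\<lambda>z. if i = coord k then (-1) ^ k * coeff (P z) k else 0) holomorphic_on ball 0 1" for k
      by (cases "i = coord k") (auto intro!: holomorphic_intros poly_discD(1)[OF disc])
    then show "(\<lambda>z. axis_point (P z) $ i) holomorphic_on ball 0 1"
      unfolding axis_point_def by (auto intro!: holomorphic_on_sum)
  qed
  moreover have "(\<lambda>z. axis_point (P z)) ` ball 0 1 \<subseteq> E"
    using poly_discD(2-4)[OF disc] by (auto intro!: axis_point_in_tetrablock)
  ultimately show ?thesis
    unfolding lempert_def using ab by (intro Inf_lower) force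
qed

lemma poly_disc_axis_poly:
  assumes f: "holomorphic_curve_on f (ball 0 1)" "f ` ball 0 1 \<subseteq> E"
    and M: "M holomorphic_on ball 0 1" "\<And>z. norm z < 1 \<Longrightarrow> norm (M z) < 1"
  shows "poly_disc (r J) (\<lambda>z. axis_poly (f (M z)))"
  unfolding poly_disc_def
proof (intro conjI allI impI)
  show "(\<lambda>z. coeff (axis_poly (f (M z))) j) holomorphic_on ball 0 1" for j
  proof -
    have "(\<lambda>z. f z $ i) holomorphic_on ball 0 1" for i
      using f(1) by (simp add: holomorphic_curve_on_def)
    then have "(\<lambda>z. f (M z) $ i) holomorphic_on ball 0 1" for i
      using holomorphic_on_compose_gen[OF M(1), of "\<lambda>z. f z $ i" "ball 0 1"] M(2)
      by (auto simp: o_def image_subset_iff)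
    then show ?thesis
      unfolding coeff_axis_poly
      by (cases "j = 0"; cases "j \<le> r J") (auto intro!: holomorphic_intros)
  qed
  show "poly (axis_poly (f (M z))) w \<noteq> 0" if "norm z < 1" "norm w \<le> 1" for z w
    using f(2) M(2)[OF that(1)] that(2) by (intro axis_poly_zero_free) auto
qed (auto simp: coeff_axis_poly degree_axis_poly)

section \<open>Failure of the triangle inequality\<close>

text \<open>The two halves of the path are bounded by the discs \<open>Q 1\<close> and \<open>Q (-1)\<close> themselves.  For the lower bound,
  any disc through \<open>p\<close> and \<open>q\<close> is reparametrized by a Moebius transformation that puts \<open>q\<close> at \<open>0\<close>, and
  retracted to the slice.\<close>

lemma lempert_triangle_fails:
  assumes r3: "3 \<le> r J"
  obtains p o' q where "p \<in> E" "o' \<in> E" "q \<in> E" "lempert E p o' + lempert E o' q < lempert E p q"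
proof -
  obtain v :: "complex poly" and \<tau> :: real
    where \<tau>: "0 < \<tau>" "\<tau> < 1 / 2"
      and v: "degree v \<le> r J - 3" "coeff v 0 = 1" "\<forall>w. norm w \<le> 1 \<longrightarrow> poly v w \<noteq> 0"
      and far: "\<forall>P \<alpha>. poly_disc (r J) P \<longrightarrow> P 0 = cubic_disc (-1) (- \<tau>) * v
        \<longrightarrow> P \<alpha> = cubic_disc 1 \<tau> * v \<longrightarrow> norm \<alpha> < 1 \<longrightarrow> 2 * \<tau> \<le> norm \<alpha>"
    by (rule exists_far_polynomials[OF r3])
  define Q where "Q = (\<lambda>e z. cubic_disc e z * v)"
  have Q: "poly_disc (r J) (Q e)" if "e = 1 \<or> e = -1" for e
    unfolding Q_def using poly_disc_cubic[OF that r3] v by blast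
  define p o' q where "p = axis_point (Q 1 \<tau>)" and "o' = axis_point v" and "q = axis_point (Q (-1) (- \<tau>))"
  have n\<tau>: "norm (complex_of_real \<tau>) < 1" "norm (- complex_of_real \<tau>) < 1" using \<tau> by auto
  have in_E: "p \<in> E" "o' \<in> E" "q \<in> E"
    unfolding p_def o'_def q_def using v n\<tau> poly_discD(2-4)[OF Q]
    by (auto intro!: axis_point_in_tetrablock)
  have Q00: "Q e 0 = v" for e by (simp add: Q_def)
  have "lempert E p o' \<le> ereal (artanh \<tau>)"
    using lempert_le_axis_disc[OF Q, of 1 "\<tau>" 0] n\<tau> \<tau>
    by (simp add: p_def o'_def Q00 poincare_dist_def)
  moreover have "lempert E o' q \<le> ereal (artanh \<tau>)"
    using lempert_le_axis_disc[OF Q, of "-1" 0 "- \<tau>"] n\<tau> \<tau>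
    by (simp add: q_def o'_def Q00 poincare_dist_def)
  ultimately have upper: "lempert E p o' + lempert E o' q \<le> ereal (artanh \<tau> + artanh \<tau>)"
    unfolding plus_ereal.simps(1)[symmetric] by (rule add_mono)
  have strict: "artanh \<tau> + artanh \<tau> < artanh (2 * \<tau>)"
  proof -
    have "1 < 1 + \<tau> * \<tau>" using \<tau> by simp
    then have "(\<tau> + \<tau>) / (1 + \<tau> * \<tau>) < (\<tau> + \<tau>) / 1"
      using \<tau> by (intro divide_strict_left_mono) (auto intro: add_pos_pos)
    then have "(\<tau> + \<tau>) / (1 + \<tau> * \<tau>) < 2 * \<tau>" by simp
    moreover have "0 \<le> (\<tau> + \<tau>) / (1 + \<tau> * \<tau>)"
      using \<tau> by (intro divide_nonneg_nonneg) auto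
    ultimately have "artanh ((\<tau> + \<tau>) / (1 + \<tau> * \<tau>)) < artanh (2 * \<tau>)"
      using \<tau>(2) by (intro artanh_real_strict_mono) linarith+
    moreover have "artanh \<tau> + artanh \<tau> = artanh ((\<tau> + \<tau>) / (1 + \<tau> * \<tau>))"
      using \<tau> by (intro artanh_real_add) auto
    ultimately show ?thesis by linarith
  qed
  have "ereal (artanh (2 * \<tau>)) \<le> lempert E p q"
    unfolding lempert_def
  proof (rule Inf_greatest)
    fix x
    assume "x \<in> {ereal (poincare_dist a b) | a b. a \<in> ball 0 1 \<and> b \<in> ball 0 1 \<and>
       (\<exists>f. holomorphic_curve_on f (ball 0 1) \<and> f ` ball 0 1 \<subseteq> E \<and> f a = p \<and> f b = q)}"
    then obtain a b f where x: "x = ereal (poincare_dist a b)"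
      and a: "a \<in> ball 0 1" and b: "b \<in> ball 0 1" and f: "holomorphic_curve_on f (ball 0 1)"
      "f ` ball 0 1 \<subseteq> E" and fab: "f a = p" "f b = q" by blast
    define M where "M = Moebius_function 0 (- b)"
    define \<alpha> where "\<alpha> = Moebius_function 0 b a"
    have M: "M holomorphic_on ball 0 1" "\<And>z. norm z < 1 \<Longrightarrow> norm (M z) < 1"
      unfolding M_def using b by (auto intro: Moebius_function_holomorphic Moebius_function_norm_lt_1)
    have M0: "M 0 = b" by (simp add: M_def Moebius_function_simple)
    have M\<alpha>: "M \<alpha> = a"
      unfolding M_def \<alpha>_def using a b by (intro Moebius_function_compose) auto
    have \<alpha>: "norm \<alpha> < 1"
      unfolding \<alpha>_def using a b by (intro Moebius_function_norm_lt_1) auto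
    have restr: "axis_poly (axis_point (Q e z)) = cubic_disc e z * v"
      if "e = 1 \<or> e = -1" "norm z < 1" for e z
      using axis_poly_axis_point poly_discD(2,3)[OF Q] that by (simp add: Q_def)
    have "axis_poly (f (M 0)) = cubic_disc (-1) (- \<tau>) * v"
      "axis_poly (f (M \<alpha>)) = cubic_disc 1 \<tau> * v"
      unfolding M0 M\<alpha> fab p_def q_def using restr n\<tau> by auto
    then have "2 * \<tau> \<le> norm \<alpha>"
      using far poly_disc_axis_poly[OF f M] \<alpha> by blast
    then show "ereal (artanh (2 * \<tau>)) \<le> x"
      unfolding x poincare_dist_Moebius \<alpha>_def[symmetric] using \<tau> \<alpha>
      by (simp add: artanh_real_mono)
  qed
  then have "lempert E p o' + lempert E o' q < lempert E p q"
    using upper strict by (meson le_less_trans less_ereal.simps(1) less_le_trans)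
  then show thesis using that in_E by blast
qed

end

theorem proposition3p10:
  fixes n s :: nat and r :: "nat \<Rightarrow> nat"
    and E :: "(complex ^ 'N::{finite,linorder}) set"
  assumes "n \<ge> 2" and "1 \<le> s" and "s \<le> n"
    and "\<forall>j\<in>{1..s}. r j > 0"
    and "(\<Sum>j=1..s. r j) = n"
    and "CARD('N) = (\<Prod>j=1..s. (r j + 1)) - 1"
    and "E = gen_tetrablock s r"
    and "\<exists>j\<in>{1..s}. r j \<ge> 3"
  shows "\<not> is_distance_on E (lempert E)
    \<and> (\<exists>z\<in>E. \<exists>w\<in>E. caratheodory E z w \<noteq> lempert E z w)"
proof -
  obtain J where axis: "J \<in> {1..s}" "3 \<le> r J" using assms(8) by blast
  interpret tetrablock_axis s r J "\<lambda>i::'N. nth_multi_index s r (position i)"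
    by unfold_locales (use axis assms(6) in auto)
  obtain p o' q where pq: "p \<in> E" "o' \<in> E" "q \<in> E"
    and less: "lempert E p o' + lempert E o' q < lempert E p q"
    using lempert_triangle_fails[OF axis(2)] unfolding assms(7) by blast
  have "\<not> is_distance_on E (lempert E)"
  proof
    assume "is_distance_on E (lempert E)"
    then obtain d where d: "Metric_space E d" "\<And>z w. z \<in> E \<Longrightarrow> w \<in> E \<Longrightarrow> lempert E z w = ereal (d z w)"
      unfolding is_distance_on_def by blast
    have "d p q \<le> d p o' + d o' q" using Metric_space.triangle[OF d(1)] pq by blast
    then show False using less pq by (simp add: d(2))
  qed
  moreover have "\<exists>z\<in>E. \<exists>w\<in>E. caratheodory E z w \<noteq> lempert E z w"
  proof (rule ccontr)
    assume "\<not> ?thesis"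
    then have eq: "\<And>z w. z \<in> E \<Longrightarrow> w \<in> E \<Longrightarrow> caratheodory E z w = lempert E z w" by blast
    show False
      using caratheodory_triangle[OF pq] less pq by (simp add: eq)
  qed
  ultimately show ?thesis by blast
qed

end
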